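(* Let $\{(\mu_t,\nu_t)\}_{t\ge0}$ be a weakly continuous $\rhd_c$-convolution semigroup in $\mathcal{P}(\mathbb{T})\times\mathcal{P}(\mathbb{T})$ with $(\mu_0,\nu_0)=(\delta_1,\delta_1)$. Then there exist analytic functions $B_1,B_2:\mathbb{D}\to\mathbb{C}$ with $\operatorname{Re}B_1\le0$ and $\operatorname{Re}B_2\le0$ such that, for all $t\ge0$ and $z\in\mathbb{D}$, $$\frac{d}{dt}\eta_{\mu_t}(z)=\eta_{\mu_t}(z)\,B_1(\eta_{\nu_t}(z)),\qquad \frac{d}{dt}\eta_{\nu_t}(z)=\eta_{\nu_t}(z)\,B_2(\eta_{\nu_t}(z)).$$ Conversely, given analytic $B_1,B_2:\mathbb{D}\to\mathbb{C}$ with $\operatorname{Re}B_1,\operatorname{Re}B_2\le0$, there exists a weakly continuous $\rhd_c$-convolution semigroup $\{(\mu_t,\nu_t)\}_{t\ge0}$ with $(\mu_0,\nu_0)=(\delta_1,\delta_1)$ satisfying these two differential equations. Moreover, each such $B_j$ ($j=1,2$) can be written as $$B_j(z)=i\gamma_j+\int_{\mathbb{T}}\frac{z+\zeta}{z-\zeta}\,\tau_j(d\zeta),$$ with $\gamma_j\in\mathbb{R}$ and $\tau_j$ a positive finite Borel measure on $\mathbb{T}$.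
   Context: $\mathbb{T}$ is the unit circle, $\mathbb{D}$ the open unit disc, and $\mathcal{P}(\mathbb{T})$ the set of Borel probability measures on $\mathbb{T}$. For $\mu\in\mathcal{P}(\mathbb{T})$ let $\psi_\mu(z)=\int_{\mathbb{T}}\frac{z\zeta}{1-z\zeta}d\mu(\zeta)$ and $\eta_\mu=\psi_\mu/(1+\psi_\mu)$ on $\mathbb{D}$. The function $\eta_\mu$ determines $\mu$, and the analytic functions $\eta:\mathbb{D}\to\mathbb{C}$ of this form are exactly those with $|\eta(z)|\le|z|$. $\delta_1$ is the Dirac mass at $1$. The multiplicative conditionally monotone convolution on $\mathcal{P}(\mathbb{T})\times\mathcal{P}(\mathbb{T})$ is $(\mu_1,\nu_1)\rhd_c(\mu_2,\nu_2)=(\mu,\nu)$, where $$\eta_\nu=\eta_{\nu_1}\circ\eta_{\nu_2},\qquad \eta_\mu(z)=\eta_{\mu_2}(z)\,h_{\mu_1}(\eta_{\nu_2}(z)),\quad h_{\mu_1}(w)=\eta_{\mu_1}(w)/w\ \ (h_{\mu_1}(0)=\eta_{\mu_1}'(0)).$$ The right component is the multiplicative monotone convolution $\nu_1\rhd\nu_2$. A weakly continuous $\rhd_c$-convolution semigroup is a family $\{(\mu_t,\nu_t)\}_{t\ge0}$ in $\mathcal{P}(\mathbb{T})^2$ with $(\mu_{s+t},\nu_{s+t})=(\mu_s,\nu_s)\rhd_c(\mu_t,\nu_t)$ for all $s,t\ge0$, such that $t\mapsto\mu_t$ and $t\mapsto\nu_t$ are weakly continuous. *)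

theory Defs
  imports "HOL-Probability.Probability" "HOL-Complex_Analysis.Complex_Analysis"
begin

definition circle_borel :: "complex measure" where
  "circle_borel = restrict_space borel (sphere 0 1)"

definition unit_disc :: "complex set" where
  "unit_disc = ball 0 1"

definition prob_T :: "complex measure \<Rightarrow> bool" where
  "prob_T \<mu> \<longleftrightarrow> prob_space \<mu> \<and> sets \<mu> = sets circle_borel"

definition finite_meas_T :: "complex measure \<Rightarrow> bool" where
  "finite_meas_T \<tau> \<longleftrightarrow> finite_measure \<tau> \<and> sets \<tau> = sets circle_borel"

definition delta1 :: "complex measure" where
  "delta1 = return circle_borel 1"

definition psi_tr :: "complex measure \<Rightarrow> complex \<Rightarrow> complex" where
  "psi_tr \<mu> z = (\<integral>\<zeta>. z * \<zeta> / (1 - z * \<zeta>) \<partial>\<mu>)"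

definition eta_tr :: "complex measure \<Rightarrow> complex \<Rightarrow> complex" where
  "eta_tr \<mu> z = psi_tr \<mu> z / (1 + psi_tr \<mu> z)"

definition h_tr :: "complex measure \<Rightarrow> complex \<Rightarrow> complex" where
  "h_tr \<mu> w = (if w = 0 then deriv (eta_tr \<mu>) 0 else eta_tr \<mu> w / w)"

text \<open>(mu1,nu1) |>_c (mu2,nu2) = (mu,nu), characterised (as in the paper) through the eta-transforms,
  which determine the measures.\<close>
definition cmc_conv ::
  "complex measure \<Rightarrow> complex measure \<Rightarrow> complex measure \<Rightarrow> complex measure
   \<Rightarrow> complex measure \<Rightarrow> complex measure \<Rightarrow> bool" where
  "cmc_conv \<mu>1 \<nu>1 \<mu>2 \<nu>2 \<mu> \<nu> \<longleftrightarrow>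
     (\<forall>z\<in>unit_disc. eta_tr \<nu> z = eta_tr \<nu>1 (eta_tr \<nu>2 z) \<and>
                     eta_tr \<mu> z = eta_tr \<mu>2 z * h_tr \<mu>1 (eta_tr \<nu>2 z))"

definition weakly_continuous :: "(real \<Rightarrow> complex measure) \<Rightarrow> bool" where
  "weakly_continuous \<mu> \<longleftrightarrow>
     (\<forall>f :: complex \<Rightarrow> real. continuous_on (sphere 0 1) f \<longrightarrow>
        continuous_on {0..} (\<lambda>t. \<integral>\<zeta>. f \<zeta> \<partial>(\<mu> t)))"

definition cmc_semigroup :: "(real \<Rightarrow> complex measure) \<Rightarrow> (real \<Rightarrow> complex measure) \<Rightarrow> bool" where
  "cmc_semigroup \<mu> \<nu> \<longleftrightarrow>
     (\<forall>t\<ge>0. prob_T (\<mu> t) \<and> prob_T (\<nu> t)) \<and>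
     (\<forall>s\<ge>0. \<forall>t\<ge>0. cmc_conv (\<mu> s) (\<nu> s) (\<mu> t) (\<nu> t) (\<mu> (s + t)) (\<nu> (s + t))) \<and>
     weakly_continuous \<mu> \<and> weakly_continuous \<nu>"

definition cmc_ode :: "(real \<Rightarrow> complex measure) \<Rightarrow> (real \<Rightarrow> complex measure)
     \<Rightarrow> (complex \<Rightarrow> complex) \<Rightarrow> (complex \<Rightarrow> complex) \<Rightarrow> bool" where
  "cmc_ode \<mu> \<nu> B1 B2 \<longleftrightarrow>
     (\<forall>t\<ge>0. \<forall>z\<in>unit_disc.
        ((\<lambda>s. eta_tr (\<mu> s) z) has_vector_derivative
            (eta_tr (\<mu> t) z * B1 (eta_tr (\<nu> t) z))) (at t within {0..}) \<and>
        ((\<lambda>s. eta_tr (\<nu> s) z) has_vector_derivative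
            (eta_tr (\<nu> t) z * B2 (eta_tr (\<nu> t) z))) (at t within {0..}))"

definition admissible_B :: "(complex \<Rightarrow> complex) \<Rightarrow> bool" where
  "admissible_B B \<longleftrightarrow> B holomorphic_on unit_disc \<and> (\<forall>z\<in>unit_disc. Re (B z) \<le> 0)"

end

theory Submission
  imports Defs "HOL-Real_Asymp.Real_Asymp"
begin

text \<open>Forward direction. Weak continuity makes the \<open>\<eta>\<close>-transforms \<open>f\<^sub>t\<close> of \<open>\<nu>\<^sub>t\<close> a semiflow that is jointly
  continuous in \<open>(t, z)\<close>. Its average \<open>F\<^sub>a(z)\<close>, the integral of \<open>f\<^sub>s(z)\<close> over \<open>[0, a]\<close>, satisfies \<open>F\<^sub>a(f\<^sub>t(z)) =\<close> the integral
  of \<open>f\<^sub>s(z)\<close> over \<open>[t, t + a]\<close>, which is continuously differentiable in \<open>t\<close>; for small \<open>a\<close> the map \<open>F\<^sub>a\<close> is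
  locally invertible, so \<open>f\<^sub>t(z)\<close> is differentiable in \<open>t\<close> as well, with a holomorphic generator. The same
  averaging applies to the functions \<open>h\<close> of \<open>\<mu>\<^sub>t\<close> and of \<open>\<nu>\<^sub>t\<close>, which are multiplicative cocycles over this
  semiflow; their generators are \<open>B\<^sub>1\<close> and \<open>B\<^sub>2\<close>, and the Schwarz lemma gives the sign of the real parts.

  Converse. The equation \<open>f' = f B\<^sub>2(f)\<close> is solved for all times by iterating
  \<open>f \<mapsto> z exp(\<integral> B\<^sub>2(f))\<close>, and the \<open>\<eta>\<close>-transform of \<open>\<mu>\<^sub>t\<close> is \<open>z exp(\<integral> B\<^sub>1(f))\<close>. Measures with these
  transforms exist by the Herglotz representation, which follows from the Schwarz integral formula on
  circles of radius below one and Helly's selection theorem. Weak continuity follows from that of the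
  moments, by the Weierstrass approximation theorem.\<close>

section \<open>Transforms of measures on the circle\<close>

lemma finite_meas_T_if_prob_T: "prob_T \<mu> \<Longrightarrow> finite_meas_T \<mu>"
  by (simp add: prob_T_def finite_meas_T_def prob_space.finite_measure)

lemma space_finite_meas_T: "finite_meas_T \<mu> \<Longrightarrow> space \<mu> = sphere 0 1"
  by (metis Int_UNIV_right circle_borel_def finite_meas_T_def sets_eq_imp_space_eq space_borel space_restrict_space)

lemma integrable_finite_meas_T:
  fixes f :: "complex \<Rightarrow> 'b::{banach, second_countable_topology}"
  assumes \<mu>: "finite_meas_T \<mu>" and f: "continuous_on (sphere 0 1) f"
  shows "integrable \<mu> f"
proof -
  interpret finite_measure \<mu> using \<mu> by (simp add: finite_meas_T_def)
  have m: "f \<in> borel_measurable \<mu>"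
    using borel_measurable_continuous_on_restrict[OF f] \<mu>
    by (metis circle_borel_def finite_meas_T_def measurable_cong_sets)
  have "bounded (f ` sphere 0 1)"
    by (intro compact_imp_bounded compact_continuous_image f) auto
  then obtain C where C: "\<And>\<zeta>. \<zeta> \<in> sphere 0 1 \<Longrightarrow> norm (f \<zeta>) \<le> C"
    unfolding bounded_iff by (meson imageI)
  show ?thesis
    by (rule integrable_const_bound[of _ C]) (use C m space_finite_meas_T[OF \<mu>] in auto)
qed

lemma norm_integral_prob_T_le:
  fixes f :: "complex \<Rightarrow> 'b::{banach, second_countable_topology}"
  assumes \<mu>: "prob_T \<mu>" and f: "continuous_on (sphere 0 1) f"
    and C: "\<And>\<zeta>. \<zeta> \<in> sphere 0 1 \<Longrightarrow> norm (f \<zeta>) \<le> C"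
  shows "norm (\<integral>\<zeta>. f \<zeta> \<partial>\<mu>) \<le> C"
proof -
  interpret prob_space \<mu> using \<mu> by (simp add: prob_T_def)
  note i = integrable_finite_meas_T[OF finite_meas_T_if_prob_T[OF \<mu>]]
  have "norm (\<integral>\<zeta>. f \<zeta> \<partial>\<mu>) \<le> (\<integral>\<zeta>. norm (f \<zeta>) \<partial>\<mu>)" by simp
  also have "\<dots> \<le> (\<integral>\<zeta>. C \<partial>\<mu>)"
    by (rule integral_mono)
       (use C f space_finite_meas_T[OF finite_meas_T_if_prob_T[OF \<mu>]] in \<open>auto intro!: i continuous_intros\<close>)
  also have "\<dots> = C" by (simp add: prob_space)
  finally show ?thesis .
qed

lemma disc_kernel_nonzero:
  fixes z \<zeta> :: complex
  assumes "norm z < 1" "norm \<zeta> = 1"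
  shows "1 - z * \<zeta> \<noteq> 0" "z * \<zeta> \<noteq> 1" "1 \<noteq> z * \<zeta>"
proof -
  show "z * \<zeta> \<noteq> 1" using assms by (metis less_irrefl mult.right_neutral norm_mult norm_one)
  then show "1 - z * \<zeta> \<noteq> 0" "1 \<noteq> z * \<zeta>" by auto
qed

lemma weakly_continuous_complex:
  fixes f :: "complex \<Rightarrow> complex"
  assumes w: "weakly_continuous \<mu>" and \<mu>: "\<And>t. t \<ge> 0 \<Longrightarrow> prob_T (\<mu> t)"
    and f: "continuous_on (sphere 0 1) f"
  shows "continuous_on {0..} (\<lambda>t. \<integral>\<zeta>. f \<zeta> \<partial>(\<mu> t))"
proof -
  have "continuous_on {0..} (\<lambda>t. Complex (\<integral>\<zeta>. Re (f \<zeta>) \<partial>(\<mu> t)) (\<integral>\<zeta>. Im (f \<zeta>) \<partial>(\<mu> t)))"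
    unfolding Complex_eq
    by (intro continuous_intros; use w f in \<open>auto simp: weakly_continuous_def intro!: continuous_intros\<close>)
  moreover have "(\<integral>\<zeta>. f \<zeta> \<partial>(\<mu> t)) = Complex (\<integral>\<zeta>. Re (f \<zeta>) \<partial>(\<mu> t)) (\<integral>\<zeta>. Im (f \<zeta>) \<partial>(\<mu> t))"
    if "t \<ge> 0" for t
    using integrable_finite_meas_T[OF finite_meas_T_if_prob_T[OF \<mu>[OF that]] f]
    by (simp add: complex_eq_iff integral_Re integral_Im)
  ultimately show ?thesis using continuous_on_eq by fastforce
qed

text \<open>Two errors are separated: moving \<open>z\<close> changes the integrand uniformly on the
  compact circle, which is harmless for all probability measures alike, and moving \<open>t\<close>
  with \<open>z0\<close> fixed is weak continuity.\<close>

lemma continuous_on_kernel_integral: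
  fixes k :: "complex \<Rightarrow> complex \<Rightarrow> complex"
  assumes w: "weakly_continuous \<mu>" and \<mu>: "\<And>t. t \<ge> 0 \<Longrightarrow> prob_T (\<mu> t)"
    and k: "continuous_on (U \<times> sphere 0 1) (\<lambda>(z, \<zeta>). k z \<zeta>)"
  shows "continuous_on ({0..} \<times> U) (\<lambda>(t, z). \<integral>\<zeta>. k z \<zeta> \<partial>(\<mu> t))"
proof (clarsimp simp: continuous_on_def)
  fix t0 :: real and z0 assume t0: "0 \<le> t0" and z0: "z0 \<in> U"
  have kc: "continuous_on (sphere 0 1) (k z)" if "z \<in> U" for z
    using continuous_on_compose2[OF k, of "sphere 0 1" "\<lambda>\<zeta>. (z, \<zeta>)"] that
    by (force intro: continuous_intros)
  show "((\<lambda>(t, z). \<integral>\<zeta>. k z \<zeta> \<partial>(\<mu> t)) \<longlongrightarrow> (\<integral>\<zeta>. k z0 \<zeta> \<partial>(\<mu> t0))) (at (t0, z0) within {0..} \<times> U)"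
  proof (rule tendstoI)
    fix e :: real assume e: "e > 0"
    obtain X0 where X0: "z0 \<in> X0" "open X0"
      and X: "\<forall>z\<in>X0 \<inter> U. \<forall>\<zeta>\<in>sphere 0 1. dist (k z \<zeta>) (k z0 \<zeta>) \<le> e/2"
      using continuous_on_prod_compactE[OF k compact_sphere z0, of "e/2"] e by auto
    have "((\<lambda>t. \<integral>\<zeta>. k z0 \<zeta> \<partial>(\<mu> t)) \<longlongrightarrow> (\<integral>\<zeta>. k z0 \<zeta> \<partial>(\<mu> t0))) (at t0 within {0..})"
      using weakly_continuous_complex[OF w \<mu> kc[OF z0]] t0 by (auto simp: continuous_on_def)
    then have "\<forall>\<^sub>F t in at t0 within {0..}. dist (\<integral>\<zeta>. k z0 \<zeta> \<partial>(\<mu> t)) (\<integral>\<zeta>. k z0 \<zeta> \<partial>(\<mu> t0)) < e/2"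
      by (rule tendstoD) (use e in auto)
    then obtain T where T: "open T" "t0 \<in> T"
      and T': "\<And>t. t \<in> T \<Longrightarrow> t \<noteq> t0 \<Longrightarrow> 0 \<le> t \<Longrightarrow>
         dist (\<integral>\<zeta>. k z0 \<zeta> \<partial>(\<mu> t)) (\<integral>\<zeta>. k z0 \<zeta> \<partial>(\<mu> t0)) < e/2"
      by (auto simp: eventually_at_topological)
    have "dist (\<integral>\<zeta>. k z \<zeta> \<partial>(\<mu> t)) (\<integral>\<zeta>. k z0 \<zeta> \<partial>(\<mu> t0)) < e"
      if "t \<in> T" "z \<in> X0" "0 \<le> t" "z \<in> U" for t z
    proof -
      note i = integrable_finite_meas_T[OF finite_meas_T_if_prob_T[OF \<mu>[OF \<open>0 \<le> t\<close>]]]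
      have "dist (\<integral>\<zeta>. k z \<zeta> \<partial>(\<mu> t)) (\<integral>\<zeta>. k z0 \<zeta> \<partial>(\<mu> t)) = norm (\<integral>\<zeta>. k z \<zeta> - k z0 \<zeta> \<partial>(\<mu> t))"
        using that z0 by (simp add: dist_norm i kc)
      also have "\<dots> \<le> e/2"
        by (rule norm_integral_prob_T_le)
          (use that z0 X \<mu> in \<open>auto intro!: continuous_intros kc simp: dist_norm\<close>)
      finally have a: "dist (\<integral>\<zeta>. k z \<zeta> \<partial>(\<mu> t)) (\<integral>\<zeta>. k z0 \<zeta> \<partial>(\<mu> t)) \<le> e/2" .
      have b: "dist (\<integral>\<zeta>. k z0 \<zeta> \<partial>(\<mu> t)) (\<integral>\<zeta>. k z0 \<zeta> \<partial>(\<mu> t0)) < e/2"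
        using T'[of t] that e by (cases "t = t0") auto
      show ?thesis
        using a b dist_triangle[of "\<integral>\<zeta>. k z \<zeta> \<partial>(\<mu> t)" "\<integral>\<zeta>. k z0 \<zeta> \<partial>(\<mu> t0)" "\<integral>\<zeta>. k z0 \<zeta> \<partial>(\<mu> t)"] by linarith
    qed
    then show "\<forall>\<^sub>F x in at (t0, z0) within {0..} \<times> U.
        dist (case x of (t, z) \<Rightarrow> \<integral>\<zeta>. k z \<zeta> \<partial>(\<mu> t)) (\<integral>\<zeta>. k z0 \<zeta> \<partial>(\<mu> t0)) < e"
      unfolding eventually_at_topological
      by (intro exI[of _ "T \<times> X0"]) (auto intro!: open_Times T X0)
  qed
qed

text \<open>Common building block of the transforms: on the disc \<open>1 + psi_tr\<close> is the
  case \<open>k = 0\<close>, \<open>psi_tr\<close> is \<open>z\<close> times the case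
  \<open>k = 1\<close>, and the values at \<open>z = 0\<close> are the moments of the
  measure.\<close>

definition cauchy_moment :: "complex measure \<Rightarrow> nat \<Rightarrow> complex \<Rightarrow> complex" where
  "cauchy_moment \<mu> k z = (\<integral>\<zeta>. \<zeta> ^ k / (1 - z * \<zeta>) \<partial>\<mu>)"

lemma continuous_on_cauchy_moment_joint:
  assumes "weakly_continuous \<mu>" and "\<And>t. t \<ge> 0 \<Longrightarrow> prob_T (\<mu> t)"
  shows "continuous_on ({0..} \<times> ball 0 1) (\<lambda>(t, z). cauchy_moment (\<mu> t) k z)"
  unfolding cauchy_moment_def
  by (rule continuous_on_kernel_integral)
     (use assms disc_kernel_nonzero in \<open>auto simp: case_prod_beta intro!: continuous_intros\<close>)

lemma holomorphic_cauchy_moment: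
  assumes \<mu>: "prob_T \<mu>"
  shows "cauchy_moment \<mu> k holomorphic_on ball 0 1"
proof -
  have "\<exists>D. (cauchy_moment \<mu> k has_field_derivative D) (at z)" if z: "z \<in> ball 0 1" for z
  proof -
    \<comment> \<open>The integrated difference quotient of the kernel; its continuity at
      \<open>w = z\<close> gives complex differentiability. It follows from joint continuity for a
      family constant in \<open>t\<close>, which is trivially weakly continuous.\<close>
    define q where "q w = (\<integral>\<zeta>. \<zeta> ^ Suc k / ((1 - w * \<zeta>) * (1 - z * \<zeta>)) \<partial>\<mu>)" for w
    have "continuous_on ({0..} \<times> ball 0 1) (\<lambda>(t::real, w). q w)"
      unfolding q_def
      by (rule continuous_on_kernel_integral)
         (use \<mu> z in \<open>auto simp: weakly_continuous_def case_prod_beta intro!: continuous_intros simp: disc_kernel_nonzero\<close>)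
    then have "continuous_on (ball 0 1) q"
      using continuous_on_compose2[of "{0..} \<times> ball 0 1" "\<lambda>(t::real, w). q w" "ball 0 1" "\<lambda>w. (0, w)"]
      by (force intro: continuous_intros)
    then have lim: "q \<midarrow>z\<rightarrow> q z"
      using z by (auto simp: continuous_on_eq_continuous_at isCont_def)
    have "\<forall>\<^sub>F w in at z. w \<in> ball 0 1" using z by (intro eventually_at_in_open') auto
    then have ev: "\<forall>\<^sub>F w in at z. q w = (cauchy_moment \<mu> k w - cauchy_moment \<mu> k z) / (w - z)"
      using eventually_neq_at_within[of z z UNIV]
    proof eventually_elim
      case (elim w)
      note i = integrable_finite_meas_T[OF finite_meas_T_if_prob_T[OF \<mu>]]
      have "cauchy_moment \<mu> k w - cauchy_moment \<mu> k z = (\<integral>\<zeta>. \<zeta> ^ k / (1 - w * \<zeta>) - \<zeta> ^ k / (1 - z * \<zeta>) \<partial>\<mu>)"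
        unfolding cauchy_moment_def
        by (intro Bochner_Integration.integral_diff[symmetric] i)
           (use elim z in \<open>auto intro!: continuous_intros simp: disc_kernel_nonzero\<close>)
      also have "\<dots> = (\<integral>\<zeta>. (w - z) * (\<zeta> ^ Suc k / ((1 - w * \<zeta>) * (1 - z * \<zeta>))) \<partial>\<mu>)"
      proof (intro Bochner_Integration.integral_cong refl)
        fix \<zeta> assume "\<zeta> \<in> space \<mu>"
        then have "norm \<zeta> = 1" using space_finite_meas_T[OF finite_meas_T_if_prob_T[OF \<mu>]] by auto
        then have "1 - w * \<zeta> \<noteq> 0" "1 - z * \<zeta> \<noteq> 0" using elim z disc_kernel_nonzero by auto
        then show "\<zeta> ^ k / (1 - w * \<zeta>) - \<zeta> ^ k / (1 - z * \<zeta>) =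
           (w - z) * (\<zeta> ^ Suc k / ((1 - w * \<zeta>) * (1 - z * \<zeta>)))"
          by (simp add: divide_simps) (simp add: algebra_simps)
      qed
      also have "\<dots> = (w - z) * q w" unfolding q_def by (rule integral_mult_right_zero)
      finally show ?case using elim by simp
    qed
    have "(cauchy_moment \<mu> k has_field_derivative q z) (at z)"
      unfolding has_field_derivative_iff using Lim_transform_eventually[OF lim ev] .
    then show ?thesis ..
  qed
  then show ?thesis by (simp add: holomorphic_on_open)
qed

lemma one_plus_psi_tr:
  assumes \<mu>: "prob_T \<mu>" and z: "norm z < 1"
  shows "1 + psi_tr \<mu> z = cauchy_moment \<mu> 0 z" and "psi_tr \<mu> z = z * cauchy_moment \<mu> 1 z"
proof -
  interpret prob_space \<mu> using \<mu> by (simp add: prob_T_def)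
  note i = integrable_finite_meas_T[OF finite_meas_T_if_prob_T[OF \<mu>]]
  have "1 + psi_tr \<mu> z = (\<integral>\<zeta>. 1 + z * \<zeta> / (1 - z * \<zeta>) \<partial>\<mu>)"
    unfolding psi_tr_def
    by (subst Bochner_Integration.integral_add)
       (use z in \<open>auto intro!: i continuous_intros simp: prob_space simp: disc_kernel_nonzero\<close>)
  also have "\<dots> = cauchy_moment \<mu> 0 z"
    unfolding cauchy_moment_def
  proof (intro Bochner_Integration.integral_cong refl)
    fix \<zeta> assume "\<zeta> \<in> space \<mu>"
    then have "norm \<zeta> = 1" using space_finite_meas_T[OF finite_meas_T_if_prob_T[OF \<mu>]] by auto
    then have "1 - z * \<zeta> \<noteq> 0" using z disc_kernel_nonzero by auto
    then show "1 + z * \<zeta> / (1 - z * \<zeta>) = \<zeta> ^ 0 / (1 - z * \<zeta>)" by (simp add: field_simps)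
  qed
  finally show "1 + psi_tr \<mu> z = cauchy_moment \<mu> 0 z" .
  show "psi_tr \<mu> z = z * cauchy_moment \<mu> 1 z"
    unfolding psi_tr_def cauchy_moment_def by (simp flip: integral_mult_right_zero)
qed

text \<open>For \<open>w\<close> in the disc,
  \<open>Re (1 / (1 - w)) = 1/2 + (1 - |w|^2) / (2 |1 - w|^2)\<close>. Strictness is what keeps
  \<open>eta_tr\<close> inside the open disc.\<close>

lemma Re_cauchy_moment_gt:
  assumes \<mu>: "prob_T \<mu>" and z: "norm z < 1"
  shows "Re (cauchy_moment \<mu> 0 z) > 1/2"
proof -
  interpret prob_space \<mu> using \<mu> by (simp add: prob_T_def)
  note sp = space_finite_meas_T[OF finite_meas_T_if_prob_T[OF \<mu>]]
  note i = integrable_finite_meas_T[OF finite_meas_T_if_prob_T[OF \<mu>]]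
  have i1: "integrable \<mu> (\<lambda>\<zeta>. 1 / (1 - z * \<zeta>))"
    using z by (intro i continuous_intros) (auto simp: disc_kernel_nonzero)
  \<comment> \<open>The 8 comes from \<open>|1 - w|^2 <= 4\<close>; a bound uniform on the circle
    keeps the inequality strict after integration.\<close>
  define c where "c = 1/2 + (1 - norm z ^ 2) / 8"
  have c: "c > 1/2" using z by (simp add: c_def power_less_one_iff)
  have "c \<le> Re (1 / (1 - z * \<zeta>))" if "norm \<zeta> = 1" for \<zeta>
  proof -
    define w where "w = z * \<zeta>"
    have w: "norm w = norm z" using that by (simp add: w_def norm_mult)
    define n where "n = (1 - Re w)^2 + (Im w)^2"
    have nw: "norm z ^ 2 = (Re w)^2 + (Im w)^2" using w by (simp flip: w add: cmod_power2)
    have "\<bar>Re w\<bar> < 1" using abs_Re_le_cmod[of w] w z by linarith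
    then have n0: "n > 0" unfolding n_def by (intro add_pos_nonneg) auto
    have n4: "n \<le> 4"
    proof -
      have "n = norm (1 - w) ^ 2" by (simp add: n_def cmod_power2)
      also have "norm (1 - w) \<le> 2" using norm_triangle_ineq4[of 1 w] w z by simp
      then have "norm (1 - w) ^ 2 \<le> 2 ^ 2" by (intro power_mono) auto
      finally show ?thesis by simp
    qed
    have "Re (1 / (1 - w)) = (1 - Re w) / n"
      by (simp add: Re_divide n_def)
    also have "\<dots> = 1/2 + (1 - norm z ^ 2) / (2 * n)"
      using n0 unfolding nw by (simp add: field_simps) (simp add: n_def power2_eq_square algebra_simps)
    also have "\<dots> \<ge> c"
      unfolding c_def using n0 n4 z by (intro add_left_mono divide_left_mono) (auto simp: power_le_one)
    finally show ?thesis by (simp add: w_def)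
  qed
  then have "(\<integral>\<zeta>. c \<partial>\<mu>) \<le> (\<integral>\<zeta>. Re (1 / (1 - z * \<zeta>)) \<partial>\<mu>)"
    using sp by (intro integral_mono integrable_Re i1) auto
  also have "\<dots> = Re (cauchy_moment \<mu> 0 z)"
    using i1 by (simp add: cauchy_moment_def)
  finally show ?thesis using c by (simp add: prob_space)
qed

lemma cauchy_moment_nonzero: "prob_T \<mu> \<Longrightarrow> norm z < 1 \<Longrightarrow> cauchy_moment \<mu> 0 z \<noteq> 0"
  using Re_cauchy_moment_gt by force

lemma eta_tr_eq_cauchy_moment:
  "prob_T \<mu> \<Longrightarrow> norm z < 1 \<Longrightarrow> eta_tr \<mu> z = z * (cauchy_moment \<mu> 1 z / cauchy_moment \<mu> 0 z)"
  unfolding eta_tr_def one_plus_psi_tr(1) by (simp add: one_plus_psi_tr(2))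

lemma holomorphic_eta_tr: "prob_T \<mu> \<Longrightarrow> eta_tr \<mu> holomorphic_on ball 0 1"
  by (rule holomorphic_transform[of "\<lambda>z. z * (cauchy_moment \<mu> 1 z / cauchy_moment \<mu> 0 z)"])
     (auto intro!: holomorphic_intros holomorphic_cauchy_moment simp: cauchy_moment_nonzero eta_tr_eq_cauchy_moment)

text \<open>With \<open>q\<close> the quotient on the right, \<open>eta_tr\<close> is
  \<open>z * q z\<close>, whose derivative at 0 is \<open>q 0\<close>. So the separate clause for 0
  in \<open>h_tr\<close> is just the continuous extension.\<close>

lemma h_tr_eq_cauchy_moment:
  assumes \<mu>: "prob_T \<mu>" and z: "norm z < 1"
  shows "h_tr \<mu> z = cauchy_moment \<mu> 1 z / cauchy_moment \<mu> 0 z"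
proof (cases "z = 0")
  case True
  let ?q = "\<lambda>z. cauchy_moment \<mu> 1 z / cauchy_moment \<mu> 0 z"
  have q: "?q holomorphic_on ball 0 1"
    using \<mu> by (auto intro!: holomorphic_intros holomorphic_cauchy_moment simp: cauchy_moment_nonzero)
  have "(?q has_field_derivative deriv ?q 0) (at 0)"
    by (rule holomorphic_derivI[OF q]) auto
  then have "((\<lambda>z. z * ?q z) has_field_derivative ?q 0) (at 0)"
    using DERIV_mult[OF DERIV_ident] by fastforce
  then have "(eta_tr \<mu> has_field_derivative ?q 0) (at 0)"
    by (rule has_field_derivative_transform_within_open[of _ _ _ "ball 0 1"])
       (use \<mu> in \<open>auto simp: eta_tr_eq_cauchy_moment\<close>)
  then show ?thesis using True by (simp add: h_tr_def DERIV_imp_deriv)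
qed (use assms in \<open>simp add: h_tr_def eta_tr_eq_cauchy_moment\<close>)

lemma eta_tr_eq_h_tr: "prob_T \<mu> \<Longrightarrow> norm z < 1 \<Longrightarrow> eta_tr \<mu> z = z * h_tr \<mu> z"
  by (simp add: h_tr_eq_cauchy_moment eta_tr_eq_cauchy_moment)

lemma holomorphic_h_tr: "prob_T \<mu> \<Longrightarrow> h_tr \<mu> holomorphic_on ball 0 1"
  by (rule holomorphic_transform[of "\<lambda>z. cauchy_moment \<mu> 1 z / cauchy_moment \<mu> 0 z"])
     (auto intro!: holomorphic_intros holomorphic_cauchy_moment simp: cauchy_moment_nonzero h_tr_eq_cauchy_moment)

text \<open>A number \<open>1 + p\<close> with real part above 1/2 has larger modulus than
  \<open>p\<close>, so \<open>eta_tr\<close> maps the disc into itself. It fixes 0, and the Schwarz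
  lemma gives both bounds, the second one at 0 through the derivative.\<close>

lemma norm_eta_tr_le:
  assumes \<mu>: "prob_T \<mu>" and z: "norm z < 1"
  shows "norm (eta_tr \<mu> z) \<le> norm z" and "norm (h_tr \<mu> z) \<le> 1"
proof -
  have lt: "norm (eta_tr \<mu> w) < 1" if w: "norm w < 1" for w
  proof -
    let ?p = "psi_tr \<mu> w"
    have R: "Re (1 + ?p) > 1/2"
      using Re_cauchy_moment_gt[OF \<mu> w] one_plus_psi_tr(1)[OF \<mu> w] by simp
    have "norm ?p ^ 2 < norm (1 + ?p) ^ 2"
      using R unfolding cmod_power2 by (simp add: power2_eq_square algebra_simps)
    then have "norm ?p < norm (1 + ?p)" using power_less_imp_less_base by fastforce
    moreover from this have "norm (1 + ?p) > 0" using norm_ge_zero[of ?p] by linarith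
    ultimately show ?thesis by (simp add: eta_tr_def norm_divide)
  qed
  have e0: "eta_tr \<mu> 0 = 0" using \<mu> by (simp add: eta_tr_eq_cauchy_moment)
  show le: "norm (eta_tr \<mu> z) \<le> norm z"
    by (rule Schwarz_Lemma[OF holomorphic_eta_tr[OF \<mu>] e0 lt z]) auto
  have d: "norm (deriv (eta_tr \<mu>) 0) \<le> 1"
    by (rule Schwarz_Lemma(2)[OF holomorphic_eta_tr[OF \<mu>] e0 lt z]) auto
  show "norm (h_tr \<mu> z) \<le> 1"
    using le d by (auto simp: h_tr_def norm_divide)
qed

lemma continuous_on_h_tr_joint:
  assumes w: "weakly_continuous \<mu>" and \<mu>: "\<And>t. t \<ge> 0 \<Longrightarrow> prob_T (\<mu> t)"
  shows "continuous_on ({0..} \<times> ball 0 1) (\<lambda>(t, z). h_tr (\<mu> t) z)"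
proof -
  have c: "continuous_on ({0..} \<times> ball 0 1) (\<lambda>x. cauchy_moment (\<mu> (fst x)) k (snd x))" for k
    using continuous_on_cauchy_moment_joint[OF assms] by (simp add: case_prod_beta)
  have "continuous_on ({0..} \<times> ball 0 1)
     (\<lambda>x. cauchy_moment (\<mu> (fst x)) 1 (snd x) / cauchy_moment (\<mu> (fst x)) 0 (snd x))"
    using \<mu> by (intro continuous_intros c) (auto simp: cauchy_moment_nonzero)
  then show ?thesis
    by (rule continuous_on_eq) (use \<mu> in \<open>auto simp: h_tr_eq_cauchy_moment\<close>)
qed

lemma prob_T_delta1: "prob_T delta1"
  unfolding prob_T_def delta1_def circle_borel_def
  by (auto intro!: prob_space_return simp: space_restrict_space)

lemma eta_tr_delta1: "norm z < 1 \<Longrightarrow> eta_tr delta1 z = z"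
  and h_tr_delta1: "norm z < 1 \<Longrightarrow> h_tr delta1 z = 1"
proof -
  assume z: "norm z < 1"
  have "cauchy_moment delta1 k z = 1 / (1 - z)" for k
  proof -
    have "continuous_on (sphere 0 1) (\<lambda>\<zeta>. \<zeta> ^ k / (1 - z * \<zeta>))"
      using z by (intro continuous_intros) (auto simp: disc_kernel_nonzero)
    then have "(\<lambda>\<zeta>. \<zeta> ^ k / (1 - z * \<zeta>)) \<in> borel_measurable circle_borel"
      unfolding circle_borel_def by (rule borel_measurable_continuous_on_restrict)
    then show ?thesis
      unfolding cauchy_moment_def delta1_def
      by (subst integral_return) (auto simp: circle_borel_def space_restrict_space)
  qed
  then show "h_tr delta1 z = 1"
    using z h_tr_eq_cauchy_moment[OF prob_T_delta1 z] by auto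
  then show "eta_tr delta1 z = z"
    using eta_tr_eq_h_tr[OF prob_T_delta1 z] by simp
qed

section \<open>Integrals of holomorphic families\<close>

lemma norm_deriv_le_cball:
  assumes "f holomorphic_on ball z r" "continuous_on (cball z r) f" "0 < r"
    and "\<And>x. x \<in> cball z r \<Longrightarrow> norm (f x) \<le> B"
  shows "norm (deriv f z) \<le> B / r"
  using Cauchy_inequality[of f z r B 1] assms by (simp add: dist_norm)

text \<open>Cauchy's inequality turns closeness of \<open>u t\<close> and \<open>u t0\<close>,
  uniform on a closed disc, into closeness of their derivatives; the remaining variation in
  \<open>z\<close> concerns the single function \<open>u t0\<close>.\<close>

lemma continuous_on_deriv_joint:
  fixes u :: "real \<Rightarrow> complex \<Rightarrow> complex"
  assumes c: "continuous_on (S \<times> U) (\<lambda>(t, z). u t z)" and U: "open U"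
    and h: "\<And>t. t \<in> S \<Longrightarrow> u t holomorphic_on U"
  shows "continuous_on (S \<times> U) (\<lambda>(t, z). deriv (u t) z)"
proof (clarsimp simp: continuous_on_def)
  fix t0 z0 assume t0: "t0 \<in> S" and z0: "z0 \<in> U"
  show "((\<lambda>(t, z). deriv (u t) z) \<longlongrightarrow> deriv (u t0) z0) (at (t0, z0) within S \<times> U)"
  proof (rule tendstoI)
    fix e :: real assume e: "e > 0"
    obtain r where r: "r > 0" "cball z0 r \<subseteq> U" using U z0 open_contains_cball by blast
    have c': "continuous_on (S \<times> cball z0 r) (\<lambda>(t, z). u t z)"
      using c r by (auto intro: continuous_on_subset)
    \<comment> \<open>The bound \<open>e * r / 8\<close> becomes \<open>e / 4\<close> after Cauchy's
      inequality on discs of radius \<open>r / 2\<close>.\<close>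
    obtain T where T: "t0 \<in> T" "open T"
      and T': "\<forall>t\<in>T \<inter> S. \<forall>z\<in>cball z0 r. dist (u t z) (u t0 z) \<le> e * r / 8"
      using continuous_on_prod_compactE[OF c' compact_cball t0, of "e * r / 8"] e r by auto
    have "deriv (u t0) holomorphic_on U" using h[OF t0] U by (rule holomorphic_deriv)
    then have "isCont (deriv (u t0)) z0"
      using U z0 by (meson continuous_on_eq_continuous_at holomorphic_on_imp_continuous_on)
    then obtain d where d: "d > 0" "\<And>z. dist z z0 < d \<Longrightarrow> dist (deriv (u t0) z) (deriv (u t0) z0) < e/2"
      unfolding continuous_at_eps_delta using e by (meson half_gt_zero)
    have "dist (deriv (u t) z) (deriv (u t0) z0) < e"
      if "t \<in> T" "t \<in> S" "z \<in> ball z0 (min d (r/2))" for t z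
    proof -
      have sub: "cball z (r/2) \<subseteq> cball z0 r" using that(3)
        by (intro subsetI) (smt (verit, best) dist_commute dist_triangle mem_ball mem_cball field_sum_of_halves min_less_iff_conj)
      have zU: "z \<in> U" using sub r by (meson centre_in_cball half_gt_zero less_le_not_le subsetD)
      have subU: "cball z (r/2) \<subseteq> U" using sub r by auto
      have hd: "(\<lambda>x. u t x - u t0 x) holomorphic_on cball z (r/2)"
        using h[OF \<open>t \<in> S\<close>] h[OF t0] subU
        by (intro holomorphic_on_diff) (erule (1) holomorphic_on_subset)+
      have "norm (deriv (\<lambda>x. u t x - u t0 x) z) \<le> (e * r / 8) / (r/2)"
      proof (rule norm_deriv_le_cball)
        show "(\<lambda>x. u t x - u t0 x) holomorphic_on ball z (r/2)" using hd
          by (rule holomorphic_on_subset) auto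
        show "continuous_on (cball z (r/2)) (\<lambda>x. u t x - u t0 x)" using hd
          by (rule holomorphic_on_imp_continuous_on)
        show "norm (u t x - u t0 x) \<le> e * r / 8" if "x \<in> cball z (r/2)" for x
          using T' that \<open>t \<in> T\<close> \<open>t \<in> S\<close> sub by (auto simp: dist_norm)
      qed (use r in auto)
      also have "\<dots> = e/4" using r by (simp add: field_simps)
      also have "deriv (\<lambda>x. u t x - u t0 x) z = deriv (u t) z - deriv (u t0) z"
        using h[OF \<open>t \<in> S\<close>] h[OF t0] zU U
        by (intro deriv_diff) (auto simp: holomorphic_on_imp_differentiable_at)
      finally have a: "dist (deriv (u t) z) (deriv (u t0) z) \<le> e/4" by (simp add: dist_norm)
      have b: "dist (deriv (u t0) z) (deriv (u t0) z0) < e/2"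
        using d(2)[of z] that(3) by (simp add: dist_commute)
      show ?thesis using a b e dist_triangle[of "deriv (u t) z" "deriv (u t0) z0" "deriv (u t0) z"] by linarith
    qed
    then show "\<forall>\<^sub>F x in at (t0, z0) within S \<times> U.
        dist (case x of (t, z) \<Rightarrow> deriv (u t) z) (deriv (u t0) z0) < e"
      unfolding eventually_at_topological
      using d r by (intro exI[of _ "T \<times> ball z0 (min d (r/2))"]) (auto intro!: open_Times T)
  qed
qed

lemma continuous_on_section_left:
  assumes "continuous_on (S \<times> U) (\<lambda>(t, z). u t z)" "z \<in> U" "S' \<subseteq> S"
  shows "continuous_on S' (\<lambda>t. u t z)"
proof -
  have "continuous_on S' (\<lambda>t. case (t, z) of (t, z) \<Rightarrow> u t z)"
    by (rule continuous_on_compose2[OF assms(1)]) (use assms(2,3) in \<open>auto intro!: continuous_intros\<close>)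
  then show ?thesis by simp
qed

lemma has_field_derivative_integral_param:
  fixes u :: "real \<Rightarrow> complex \<Rightarrow> complex"
  assumes c: "continuous_on ({a..b} \<times> U) (\<lambda>(t, z). u t z)" and U: "open U" "convex U"
    and h: "\<And>t. t \<in> {a..b} \<Longrightarrow> u t holomorphic_on U" and z: "z \<in> U"
  shows "((\<lambda>z. integral {a..b} (\<lambda>t. u t z)) has_field_derivative integral {a..b} (\<lambda>t. deriv (u t) z)) (at z)"
proof -
  have "continuous_on ({a..b} \<times> U) (\<lambda>(t, z). deriv (u t) z)"
    by (rule continuous_on_deriv_joint[OF c U(1) h])
  then have "continuous_on (U \<times> {a..b}) (\<lambda>(z, t). deriv (u t) z)"
    by (rule continuous_on_swap_args)
  moreover have "((u t) has_field_derivative deriv (u t) x) (at x within U)"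
    if "x \<in> U" "t \<in> {a..b}" for x t
    using h[OF that(2)] U(1) that(1) by (metis holomorphic_derivI)
  moreover have "(\<lambda>t. u t x) integrable_on {a..b}" if "x \<in> U" for x
    by (rule integrable_continuous_real) (rule continuous_on_section_left[OF c that order_refl])
  ultimately have "((\<lambda>z. integral (cbox a b) (\<lambda>t. u t z)) has_field_derivative
      integral (cbox a b) (\<lambda>t. deriv (u t) z)) (at z within U)"
    by (intro leibniz_rule_field_derivative)
       (use U z in auto)
  then show ?thesis by (simp only: at_within_open[OF z U(1)] cbox_interval)
qed

lemma holomorphic_integral_param:
  fixes u :: "real \<Rightarrow> complex \<Rightarrow> complex"
  assumes "continuous_on ({a..b} \<times> U) (\<lambda>(t, z). u t z)" "open U" "convex U"
    and "\<And>t. t \<in> {a..b} \<Longrightarrow> u t holomorphic_on U"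
  shows "(\<lambda>z. integral {a..b} (\<lambda>t. u t z)) holomorphic_on U"
  unfolding holomorphic_on_open[OF assms(2)]
  using has_field_derivative_integral_param[OF assms] by blast

section \<open>Integrals over moving time windows\<close>

lemma integral_has_vector_derivative_atLeast:
  fixes f :: "real \<Rightarrow> 'a::banach"
  assumes c: "continuous_on {a..} f" and t: "a \<le> t"
  shows "((\<lambda>u. integral {a..u} f) has_vector_derivative f t) (at t within {a..})"
proof -
  have "((\<lambda>u. integral {a..u} f) has_vector_derivative f t) (at t within {a..t+1})"
    by (rule integral_has_vector_derivative) (use c t in \<open>auto intro: continuous_on_subset\<close>)
  moreover have "at t within {a..t+1} = at t within {a..}"
    by (rule at_within_nhd[of _ "{..<t+1}"]) (use t in auto)
  ultimately show ?thesis by simp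
qed

lemma window_integral_has_vector_derivative:
  fixes f :: "real \<Rightarrow> 'a::banach"
  assumes c: "continuous_on {0..} f" and t: "0 \<le> t" and a: "0 \<le> a"
  shows "((\<lambda>t. integral {t..t+a} f) has_vector_derivative f (t + a) - f t) (at t within {0..})"
proof -
  have D: "((\<lambda>u. integral {0..u} f) has_vector_derivative f s) (at s within {0..})" if "0 \<le> s" for s
    by (rule integral_has_vector_derivative_atLeast[OF c that])
  have "((\<lambda>u. integral {0..u} f) has_vector_derivative f (t + a)) (at (t + a) within (\<lambda>u. u + a) ` {0..})"
    using D[of "t + a"] t a by (auto intro: has_vector_derivative_within_subset)
  then have "(((\<lambda>u. integral {0..u} f) \<circ> (\<lambda>u. u + a)) has_vector_derivative 1 *\<^sub>R f (t + a)) (at t within {0..})"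
    by (intro vector_diff_chain_within) (auto intro!: derivative_eq_intros)
  then have "((\<lambda>u. integral {0..u+a} f - integral {0..u} f) has_vector_derivative f (t + a) - f t) (at t within {0..})"
    using D[OF t] by (auto simp: o_def intro!: derivative_eq_intros)
  then show ?thesis
  proof (rule has_vector_derivative_transform[rotated 2])
    show "integral {s..s+a} f = integral {0..s+a} f - integral {0..s} f" if "s \<in> {0..}" for s
    proof -
      have "f integrable_on {0..s+a}"
        by (rule integrable_continuous_real) (rule continuous_on_subset[OF c], auto)
      then show ?thesis
        using Henstock_Kurzweil_Integration.integral_combine[of 0 s "s+a" f] that a
        by (simp add: algebra_simps)
    qed
  qed (use t in auto)
qed

text \<open>Otherwise the primitive of \<open>f\<close> would vanish on the half-line, and its
  one-sided derivative at 0 would be both 0 and \<open>f 0\<close>. This supplies the window lengths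
  for which averages are nondegenerate.\<close>

lemma ex_window_integral_nonzero:
  fixes f :: "real \<Rightarrow> 'a::banach"
  assumes c: "continuous_on {0..} f" and f0: "f 0 \<noteq> 0"
  shows "\<exists>a>0. integral {0..a} f \<noteq> 0"
proof (rule ccontr)
  assume "\<not> ?thesis"
  then have z: "integral {0..a} f = 0" if "a \<ge> 0" for a
    using that by (cases "a = 0") auto
  have "((\<lambda>u. integral {0..u} f) has_vector_derivative f 0) (at 0 within {0..})"
    by (rule integral_has_vector_derivative_atLeast[OF c]) auto
  then have "((\<lambda>u. 0) has_vector_derivative f 0) (at 0 within {0..})"
    by (rule has_vector_derivative_transform[rotated 2]) (use z in auto)
  then have "((\<lambda>u. 0) has_vector_derivative f 0) (at (0::real) within {0..1})"
    by (rule has_vector_derivative_within_subset) auto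
  moreover have "((\<lambda>u. 0) has_vector_derivative 0) (at (0::real) within {0..1})"
    by (rule has_vector_derivative_const)
  ultimately have "f 0 = 0"
    by (intro vector_derivative_unique_within_closed_interval[of 0 1 0 "\<lambda>u. 0"]) auto
  then show False using f0 by simp
qed

lemma has_vector_derivative_iff_tendsto:
  "(f has_vector_derivative v) (at t within S) \<longleftrightarrow>
    ((\<lambda>s. (f s - f t) /\<^sub>R (s - t)) \<longlongrightarrow> v) (at t within S)"
proof -
  have "((\<lambda>s. (f s - f t) /\<^sub>R (s - t)) \<longlongrightarrow> v) (at t within S) \<longleftrightarrow>
      ((\<lambda>s. norm ((f s - f t) /\<^sub>R (s - t) - v)) \<longlongrightarrow> 0) (at t within S)"
    by (simp add: tendsto_norm_zero_iff Lim_null[of _ v])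
  also have "\<dots> \<longleftrightarrow> ((\<lambda>s. norm (f s - f t - (s - t) *\<^sub>R v) / norm (s - t)) \<longlongrightarrow> 0) (at t within S)"
  proof (rule Lim_cong_within)
    fix s assume "s \<noteq> t"
    then have "(f s - f t) /\<^sub>R (s - t) - v = (f s - f t - (s - t) *\<^sub>R v) /\<^sub>R (s - t)"
      by (simp add: scaleR_diff_right)
    then show "norm ((f s - f t) /\<^sub>R (s - t) - v) = norm (f s - f t - (s - t) *\<^sub>R v) / norm (s - t)"
      by (simp add: divide_inverse)
  qed auto
  finally show ?thesis
    unfolding has_vector_derivative_def has_derivative_iff_norm by (simp add: bounded_linear_scaleR_left)
qed

text \<open>A continuous curve is differentiable as soon as its image under a locally invertible holomorphic
  map is: divide the increments by the difference quotient of the map.\<close>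
lemma has_vector_derivative_cancel_holomorphic:
  fixes c :: "real \<Rightarrow> complex"
  assumes \<Phi>: "(\<Phi> has_field_derivative D) (at (c t))" and D: "D \<noteq> 0"
    and c: "continuous (at t within S) c"
    and v: "((\<lambda>s. \<Phi> (c s)) has_vector_derivative v) (at t within S)"
  shows "(c has_vector_derivative v / D) (at t within S)"
proof -
  obtain q where q: "\<And>w. \<Phi> w - \<Phi> (c t) = q w * (w - c t)" "isCont q (c t)" "q (c t) = D"
    using \<Phi> by (auto simp: DERIV_caratheodory_within[of _ _ _ UNIV, simplified])
  have qc: "((\<lambda>s. q (c s)) \<longlongrightarrow> D) (at t within S)"
    using isCont_tendsto_compose[OF q(2)] c q(3) by (auto simp: continuous_within)
  have v': "((\<lambda>s. (\<Phi> (c s) - \<Phi> (c t)) /\<^sub>R (s - t)) \<longlongrightarrow> v) (at t within S)"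
    using v by (simp add: has_vector_derivative_iff_tendsto)
  have "((\<lambda>s. ((\<Phi> (c s) - \<Phi> (c t)) /\<^sub>R (s - t)) / q (c s)) \<longlongrightarrow> v / D) (at t within S)"
    by (intro tendsto_intros v' qc D)
  moreover have "\<forall>\<^sub>F s in at t within S. q (c s) \<noteq> 0"
    using tendsto_imp_eventually_ne[OF qc D] .
  then have "\<forall>\<^sub>F s in at t within S. ((\<Phi> (c s) - \<Phi> (c t)) /\<^sub>R (s - t)) / q (c s) = (c s - c t) /\<^sub>R (s - t)"
    by eventually_elim (simp add: q(1) scaleR_conv_of_real)
  ultimately show ?thesis
    by (simp add: has_vector_derivative_iff_tendsto Lim_transform_eventually)
qed

section \<open>Generators of semiflows and cocycles\<close>

lemma integral_shift_interval:
  fixes f :: "real \<Rightarrow> complex"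
  assumes "continuous_on {0..} f" "0 \<le> t"
  shows "integral {0..a} (\<lambda>s. f (s + t)) = integral {t..t+a} f"
  using integral_shift[of 0 t a f] assms
  by (simp add: o_def add.commute continuous_on_subset[OF assms(1)])

section \<open>Differentiability in time of semiflows of the disc\<close>

locale disc_semiflow =
  fixes f :: "real \<Rightarrow> complex \<Rightarrow> complex"
  assumes cont: "continuous_on ({0..} \<times> ball 0 1) (\<lambda>(t, z). f t z)"
    and holo: "0 \<le> t \<Longrightarrow> f t holomorphic_on ball 0 1"
    and maps: "0 \<le> t \<Longrightarrow> z \<in> ball 0 1 \<Longrightarrow> f t z \<in> ball 0 1"
    and flow: "0 \<le> s \<Longrightarrow> 0 \<le> t \<Longrightarrow> z \<in> ball 0 1 \<Longrightarrow> f (s + t) z = f s (f t z)"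
    and start: "z \<in> ball 0 1 \<Longrightarrow> f 0 z = z"
begin

lemma cont_time: "z \<in> ball 0 1 \<Longrightarrow> continuous_on {0..} (\<lambda>t. f t z)"
  using continuous_on_section_left[OF cont] by blast

text \<open>A one-sided derivative at time 0, meaningful only because differentiability there is
  established below.\<close>

definition generator :: "complex \<Rightarrow> complex" where
  "generator w = vector_derivative (\<lambda>s. f s w) (at 0 within {0..})"

definition avg :: "real \<Rightarrow> complex \<Rightarrow> complex" where
  "avg a z = integral {0..a} (\<lambda>s. f s z)"

lemma avg_has_field_derivative:
  assumes "z \<in> ball 0 1"
  shows "(avg a has_field_derivative integral {0..a} (\<lambda>s. deriv (f s) z)) (at z)"
  unfolding avg_def
  by (rule has_field_derivative_integral_param[where U = "ball 0 1"])
     (use assms holo in \<open>auto intro: continuous_on_subset[OF cont]\<close>)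

text \<open>The semigroup law turns composition with \<open>f t\<close> into a shift of the time
  window, and the window integral is differentiable in \<open>t\<close> although
  \<open>f s z\<close> is so far only continuous in \<open>s\<close>.\<close>

lemma avg_flow:
  assumes "0 \<le> t" "z \<in> ball 0 1"
  shows "avg a (f t z) = integral {t..t+a} (\<lambda>s. f s z)"
proof -
  have "avg a (f t z) = integral {0..a} (\<lambda>s. f (s + t) z)"
    unfolding avg_def by (rule integral_cong) (use assms flow in auto)
  then show ?thesis
    using integral_shift_interval[OF cont_time[OF assms(2)] assms(1)] by simp
qed

text \<open>The curve \<open>avg a (f s z)\<close> is a window integral, and the derivative of
  \<open>avg a\<close> is divided out. By the semigroup law the result depends on \<open>t\<close>
  and \<open>z\<close> through \<open>f t z\<close> only, which makes the equation
  autonomous.\<close>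

lemma has_vector_derivative_if_avg_regular:
  assumes t: "0 \<le> t" and z: "z \<in> ball 0 1" and a: "0 \<le> a" and ne: "deriv (avg a) (f t z) \<noteq> 0"
  shows "((\<lambda>s. f s z) has_vector_derivative (f a (f t z) - f t z) / deriv (avg a) (f t z)) (at t within {0..})"
proof (rule has_vector_derivative_cancel_holomorphic[OF _ ne])
  show "(avg a has_field_derivative deriv (avg a) (f t z)) (at (f t z))"
    using avg_has_field_derivative[OF maps[OF t z]] DERIV_imp_deriv by metis
  show "continuous (at t within {0..}) (\<lambda>s. f s z)"
    using cont_time[OF z] t by (auto simp: continuous_on_eq_continuous_within)
  have "((\<lambda>s. integral {s..s+a} (\<lambda>s. f s z)) has_vector_derivative f (t + a) z - f t z) (at t within {0..})"
    by (rule window_integral_has_vector_derivative[OF cont_time[OF z] t a])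
  moreover have "f (t + a) z = f a (f t z)"
    using flow[OF a t z] by (simp add: add.commute)
  ultimately show "((\<lambda>s. avg a (f s z)) has_vector_derivative f a (f t z) - f t z) (at t within {0..})"
    by (intro has_vector_derivative_transform[of _ _ "\<lambda>s. avg a (f s z)", rotated 2])
       (use t z avg_flow in auto)
qed

lemma generator_eq:
  assumes z: "z \<in> ball 0 1" and a: "0 \<le> a" and ne: "deriv (avg a) z \<noteq> 0"
  shows "generator z = (f a z - z) / deriv (avg a) z"
  unfolding generator_def
  by (rule vector_derivative_within)
     (use has_vector_derivative_if_avg_regular[of 0 z a] start[OF z] assms in \<open>auto simp: at_within_Ici_at_right\<close>)

text \<open>The derivative of \<open>avg a\<close> at \<open>z\<close> is the integral of
  \<open>deriv (f s) z\<close> over the window, and this integrand is 1 at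
  \<open>s = 0\<close>.\<close>

lemma ex_avg_regular:
  assumes z: "z \<in> ball 0 1"
  shows "\<exists>a>0. deriv (avg a) z \<noteq> 0"
proof -
  have "continuous_on ({0..} \<times> ball 0 1) (\<lambda>(t, z). deriv (f t) z)"
    by (rule continuous_on_deriv_joint[OF cont]) (use holo in auto)
  then have c: "continuous_on {0..} (\<lambda>t. deriv (f t) z)"
    using continuous_on_section_left z by blast
  have "(f 0 has_field_derivative 1) (at z)"
    by (rule has_field_derivative_transform_within_open[OF DERIV_ident, of "ball 0 1"])
       (use z start in auto)
  then have "deriv (f 0) z \<noteq> 0" by (simp add: DERIV_imp_deriv)
  then obtain a where "a > 0" "integral {0..a} (\<lambda>s. deriv (f s) z) \<noteq> 0"
    using ex_window_integral_nonzero[OF c] by blast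
  then show ?thesis
    using DERIV_imp_deriv[OF avg_has_field_derivative[OF z]] by metis
qed

lemma generator_ode:
  assumes t: "0 \<le> t" and z: "z \<in> ball 0 1"
  shows "((\<lambda>s. f s z) has_vector_derivative generator (f t z)) (at t within {0..})"
proof -
  obtain a where "a > 0" "deriv (avg a) (f t z) \<noteq> 0" using ex_avg_regular[OF maps[OF t z]] by blast
  then show ?thesis
    using has_vector_derivative_if_avg_regular[OF t z, of a] generator_eq[OF maps[OF t z], of a] by simp
qed

text \<open>The quotient formula for the generator holds with one fixed \<open>a\<close> on the open
  set where \<open>deriv (avg a)\<close> does not vanish. Every point lies in such a set for a
  suitable \<open>a\<close>, and holomorphy is local.\<close>

lemma holomorphic_generator: "generator holomorphic_on ball 0 1"
  unfolding holomorphic_on_open[OF open_ball]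
proof
  fix z :: complex assume z: "z \<in> ball 0 1"
  obtain a where a: "a > 0" "deriv (avg a) z \<noteq> 0" using ex_avg_regular[OF z] by blast
  have h: "avg a holomorphic_on ball 0 1"
    unfolding holomorphic_on_open[OF open_ball] using avg_has_field_derivative by blast
  have h': "deriv (avg a) holomorphic_on ball 0 1" by (rule holomorphic_deriv[OF h open_ball])
  define X where "X = ball 0 1 \<inter> deriv (avg a) -` (-{0})"
  have X: "open X" "z \<in> X"
    unfolding X_def using z a
    by (auto intro!: continuous_open_preimage holomorphic_on_imp_continuous_on h')
  have "(\<lambda>z. (f a z - z) / deriv (avg a) z) holomorphic_on X"
    by (intro holomorphic_intros holomorphic_on_subset[OF h'] holomorphic_on_subset[OF holo])
       (use a in \<open>auto simp: X_def\<close>)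
  then have "generator holomorphic_on X"
    by (rule holomorphic_transform) (use a generator_eq[of _ a] in \<open>auto simp: X_def\<close>)
  then show "\<exists>D. (generator has_field_derivative D) (at z)"
    using X by (auto simp: holomorphic_on_open)
qed

end

section \<open>Multiplicative cocycles over a semiflow\<close>

locale disc_cocycle = disc_semiflow +
  fixes g :: "real \<Rightarrow> complex \<Rightarrow> complex"
  assumes g_cont: "continuous_on ({0..} \<times> ball 0 1) (\<lambda>(t, z). g t z)"
    and g_holo: "0 \<le> t \<Longrightarrow> g t holomorphic_on ball 0 1"
    and g_cocycle: "0 \<le> s \<Longrightarrow> 0 \<le> t \<Longrightarrow> z \<in> ball 0 1 \<Longrightarrow> g (s + t) z = g t z * g s (f t z)"
    and g_start: "z \<in> ball 0 1 \<Longrightarrow> g 0 z = 1"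
begin

lemma g_cont_time: "z \<in> ball 0 1 \<Longrightarrow> continuous_on {0..} (\<lambda>t. g t z)"
  using continuous_on_section_left[OF g_cont] by blast

definition cocycle_generator :: "complex \<Rightarrow> complex" where
  "cocycle_generator w = vector_derivative (\<lambda>s. g s w) (at 0 within {0..})"

definition g_avg :: "real \<Rightarrow> complex \<Rightarrow> complex" where
  "g_avg a z = integral {0..a} (\<lambda>s. g s z)"

lemma holomorphic_g_avg: "g_avg a holomorphic_on ball 0 1"
  unfolding g_avg_def
  by (rule holomorphic_integral_param)
     (use g_holo in \<open>auto intro: continuous_on_subset[OF g_cont]\<close>)

lemma g_avg_flow:
  assumes "0 \<le> t" "z \<in> ball 0 1"
  shows "g t z * g_avg a (f t z) = integral {t..t+a} (\<lambda>s. g s z)"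
proof -
  have "g t z * g_avg a (f t z) = integral {0..a} (\<lambda>s. g t z * g s (f t z))"
    by (simp add: g_avg_def)
  also have "\<dots> = integral {0..a} (\<lambda>s. g (s + t) z)"
    by (rule integral_cong) (use assms g_cocycle in auto)
  finally show ?thesis
    using integral_shift_interval[OF g_cont_time[OF assms(2)] assms(1)] by simp
qed

text \<open>Near \<open>t\<close> the cocycle is a quotient of a window integral \<open>W\<close> by
  \<open>P s = g_avg a (f s z)\<close>. The former is differentiable as in the semiflow case, the
  latter by the chain rule and the equation for the semiflow; the quotient rule does the
  rest.\<close>

lemma cocycle_has_vector_derivative_if_regular:
  assumes t: "0 \<le> t" and z: "z \<in> ball 0 1" and a: "0 \<le> a" and ne: "g_avg a (f t z) \<noteq> 0"
  defines "w \<equiv> f t z"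
  shows "((\<lambda>s. g s z) has_vector_derivative
     g t z * ((g a w - 1 - deriv (g_avg a) w * generator w) / g_avg a w)) (at t within {0..})"
proof -
  have w: "w \<in> ball 0 1" unfolding w_def by (rule maps[OF t z])
  define W where "W s = integral {s..s+a} (\<lambda>s. g s z)" for s
  define P where "P s = g_avg a (f s z)" for s
  have W: "(W has_vector_derivative g (t + a) z - g t z) (at t within {0..})"
    unfolding W_def by (rule window_integral_has_vector_derivative[OF g_cont_time[OF z] t a])
  have P: "(P has_vector_derivative generator w * deriv (g_avg a) w) (at t within {0..})"
  proof -
    have "(g_avg a has_field_derivative deriv (g_avg a) w) (at (f t z) within (\<lambda>s. f s z) ` {0..})"
      using holomorphic_derivI[OF holomorphic_g_avg open_ball w]
      unfolding w_def by (rule has_field_derivative_at_within)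
    from field_vector_diff_chain_within[OF generator_ode[OF t z] this]
    show ?thesis by (simp add: P_def[abs_def] o_def w_def)
  qed
  have Pt: "P t \<noteq> 0" "P t = g_avg a w" using ne by (auto simp: P_def w_def)
  have "((inverse \<circ> P) has_vector_derivative (generator w * deriv (g_avg a) w) * (- (inverse (P t) ^ 2)))
      (at t within {0..})"
    by (rule field_vector_diff_chain_within[OF P])
       (use Pt DERIV_inverse[of "P t"] in \<open>auto simp: numeral_2_eq_2 intro: has_field_derivative_at_within\<close>)
  from has_vector_derivative_mult[OF W this]
  have "((\<lambda>s. W s * inverse (P s)) has_vector_derivative
      W t * ((generator w * deriv (g_avg a) w) * (- (inverse (P t) ^ 2))) + (g (t + a) z - g t z) * inverse (P t))
      (at t within {0..})"
    by (simp add: o_def)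
  moreover have "W t = g t z * P t" using g_avg_flow[OF t z] by (simp add: W_def P_def)
  moreover have "g (t + a) z = g t z * g a w"
    using g_cocycle[OF a t z] by (simp add: add.commute w_def)
  ultimately have D: "((\<lambda>s. W s * inverse (P s)) has_vector_derivative
      g t z * ((g a w - 1 - deriv (g_avg a) w * generator w) / g_avg a w)) (at t within {0..})"
    using Pt by (simp add: field_simps power2_eq_square)
  \<comment> \<open>The quotient represents \<open>g s z\<close> only where \<open>P s\<close> is
    nonzero, so the derivative is transferred on a neighbourhood of \<open>t\<close>.\<close>
  have "continuous (at t within {0..}) P" using P by (rule has_vector_derivative_continuous)
  then have "\<forall>\<^sub>F s in at t within {0..}. P s \<noteq> 0"
    using Pt(1) by (auto simp: continuous_within intro: tendsto_imp_eventually_ne)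
  then obtain d where d: "d > 0" "\<And>s. s \<in> {0..} \<Longrightarrow> s \<noteq> t \<Longrightarrow> dist s t < d \<Longrightarrow> P s \<noteq> 0"
    unfolding eventually_at by blast
  show ?thesis
  proof (rule has_vector_derivative_transform_within[OF D d(1)])
    fix s :: real assume s: "s \<in> {0..}" "dist s t < d"
    then have "P s \<noteq> 0" using d(2) Pt by (cases "s = t") auto
    then show "W s * inverse (P s) = g s z"
      using g_avg_flow[of s z] s z by (simp add: W_def P_def field_simps)
  qed (use t in auto)
qed

lemma cocycle_generator_eq:
  assumes z: "z \<in> ball 0 1" and a: "0 \<le> a" and ne: "g_avg a z \<noteq> 0"
  shows "cocycle_generator z = (g a z - 1 - deriv (g_avg a) z * generator z) / g_avg a z"
  unfolding cocycle_generator_def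
  by (rule vector_derivative_within)
     (use cocycle_has_vector_derivative_if_regular[of 0 z a] start[OF z] g_start[OF z] assms
      in \<open>auto simp: at_within_Ici_at_right\<close>)

lemma ex_g_avg_regular:
  assumes z: "z \<in> ball 0 1"
  shows "\<exists>a>0. g_avg a z \<noteq> 0"
  unfolding g_avg_def
  by (rule ex_window_integral_nonzero[OF g_cont_time[OF z]]) (use g_start[OF z] in auto)

lemma cocycle_generator_ode:
  assumes t: "0 \<le> t" and z: "z \<in> ball 0 1"
  shows "((\<lambda>s. g s z) has_vector_derivative g t z * cocycle_generator (f t z)) (at t within {0..})"
proof -
  obtain a where "a > 0" "g_avg a (f t z) \<noteq> 0" using ex_g_avg_regular[OF maps[OF t z]] by blast
  then show ?thesis
    using cocycle_has_vector_derivative_if_regular[OF t z, of a] cocycle_generator_eq[OF maps[OF t z], of a] by simp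
qed

lemma holomorphic_cocycle_generator: "cocycle_generator holomorphic_on ball 0 1"
  unfolding holomorphic_on_open[OF open_ball]
proof
  fix z :: complex assume z: "z \<in> ball 0 1"
  obtain a where a: "a > 0" "g_avg a z \<noteq> 0" using ex_g_avg_regular[OF z] by blast
  have h: "g_avg a holomorphic_on ball 0 1" by (rule holomorphic_g_avg)
  have h': "deriv (g_avg a) holomorphic_on ball 0 1" by (rule holomorphic_deriv[OF h open_ball])
  define X where "X = ball 0 1 \<inter> g_avg a -` (-{0})"
  have X: "open X" "z \<in> X"
    unfolding X_def using z a
    by (auto intro!: continuous_open_preimage holomorphic_on_imp_continuous_on h)
  have "(\<lambda>z. (g a z - 1 - deriv (g_avg a) z * generator z) / g_avg a z) holomorphic_on X"
    by (intro holomorphic_intros holomorphic_on_subset[OF h'] holomorphic_on_subset[OF h]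
          holomorphic_on_subset[OF holomorphic_generator] holomorphic_on_subset[OF g_holo])
       (use a in \<open>auto simp: X_def\<close>)
  then have "cocycle_generator holomorphic_on X"
    by (rule holomorphic_transform) (use a cocycle_generator_eq[of _ a] in \<open>auto simp: X_def\<close>)
  then show "\<exists>D. (cocycle_generator has_field_derivative D) (at z)"
    using X by (auto simp: holomorphic_on_open)
qed

text \<open>A curve that starts at 1 and stays in the closed unit disc has difference quotients at
  time 0 with nonpositive real part.\<close>

lemma Re_cocycle_generator_nonpos:
  assumes z: "z \<in> ball 0 1" and le: "\<And>t. 0 \<le> t \<Longrightarrow> norm (g t z) \<le> 1"
  shows "Re (cocycle_generator z) \<le> 0"
proof -
  have "((\<lambda>s. g s z) has_vector_derivative cocycle_generator z) (at 0 within {0..})"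
    using cocycle_generator_ode[of 0 z] z by (simp add: start g_start)
  then have "((\<lambda>s. (g s z - 1) /\<^sub>R s) \<longlongrightarrow> cocycle_generator z) (at 0 within {0..})"
    using g_start[OF z] by (simp add: has_vector_derivative_iff_tendsto)
  then have "((\<lambda>s. Re ((g s z - 1) /\<^sub>R s)) \<longlongrightarrow> Re (cocycle_generator z)) (at 0 within {0..})"
    by (rule tendsto_Re)
  moreover have "\<forall>\<^sub>F s in at 0 within {0..}. Re ((g s z - 1) /\<^sub>R s) \<le> 0"
    unfolding eventually_at
  proof (intro exI[of _ 1] conjI ballI impI)
    fix s :: real assume "s \<in> {0..}"
    then show "Re ((g s z - 1) /\<^sub>R s) \<le> 0"
      using le[of s] complex_Re_le_cmod[of "g s z"] by (auto simp: mult_nonneg_nonpos)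
  qed auto
  ultimately show ?thesis
    by (rule tendsto_upperbound) (auto simp: at_within_Ici_at_right)
qed

end

section \<open>From convolution semigroups to differential equations\<close>

lemma cmc_semigroup_imp_ode:
  assumes sg: "cmc_semigroup \<mu> \<nu>" and \<mu>0: "\<mu> 0 = delta1" and \<nu>0: "\<nu> 0 = delta1"
  shows "\<exists>B1 B2. admissible_B B1 \<and> admissible_B B2 \<and> cmc_ode \<mu> \<nu> B1 B2"
proof -
  have p\<mu>: "prob_T (\<mu> t)" and p\<nu>: "prob_T (\<nu> t)" if "0 \<le> t" for t
    using sg that by (auto simp: cmc_semigroup_def)
  have w\<mu>: "weakly_continuous \<mu>" and w\<nu>: "weakly_continuous \<nu>"
    using sg by (auto simp: cmc_semigroup_def)
  have conv: "eta_tr (\<nu> (s + t)) z = eta_tr (\<nu> s) (eta_tr (\<nu> t) z)"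
      "eta_tr (\<mu> (s + t)) z = eta_tr (\<mu> t) z * h_tr (\<mu> s) (eta_tr (\<nu> t) z)"
    if "0 \<le> s" "0 \<le> t" "z \<in> ball 0 1" for s t z
    using sg that by (auto simp: cmc_semigroup_def cmc_conv_def unit_disc_def)
  define f where "f t = eta_tr (\<nu> t)" for t
  have fz: "f t z = z * h_tr (\<nu> t) z" if "0 \<le> t" "z \<in> ball 0 1" for t z
    using that p\<nu> by (simp add: f_def eta_tr_eq_h_tr)
  have maps: "f t z \<in> ball 0 1" if "0 \<le> t" "z \<in> ball 0 1" for t z
    using norm_eta_tr_le(1)[OF p\<nu>[OF that(1)], of z] that by (simp add: f_def)
  interpret F: disc_semiflow f
  proof
    have c: "continuous_on ({0..} \<times> ball 0 1) (\<lambda>x. h_tr (\<nu> (fst x)) (snd x))"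
      using continuous_on_h_tr_joint[OF w\<nu> p\<nu>] by (simp add: case_prod_beta)
    have "continuous_on ({0..} \<times> ball 0 1) (\<lambda>x. snd x * h_tr (\<nu> (fst x)) (snd x))"
      by (intro continuous_intros c)
    then show "continuous_on ({0..} \<times> ball 0 1) (\<lambda>(t, z). f t z)"
      by (rule continuous_on_eq) (use fz in auto)
    show "f t holomorphic_on ball 0 1" if "0 \<le> t" for t
      unfolding f_def by (rule holomorphic_eta_tr[OF p\<nu>[OF that]])
    show "f (s + t) z = f s (f t z)" if "0 \<le> s" "0 \<le> t" "z \<in> ball 0 1" for s t z
      using conv(1)[OF that] by (simp add: f_def)
    show "f 0 z = z" if "z \<in> ball 0 1" for z
      using that by (simp add: f_def \<nu>0 eta_tr_delta1)
  qed (use maps in auto)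
  \<comment> \<open>Proved for a generic family \<open>\<rho>\<close>, since both
    \<open>\<mu>\<close> and \<open>\<nu>\<close> need it.\<close>
  have cocycle: "disc_cocycle f (\<lambda>t. h_tr (\<rho> t))"
    if \<rho>: "\<And>t. 0 \<le> t \<Longrightarrow> prob_T (\<rho> t)" and w: "weakly_continuous \<rho>" and \<rho>0: "\<rho> 0 = delta1"
      and conv: "\<And>s t z. 0 \<le> s \<Longrightarrow> 0 \<le> t \<Longrightarrow> z \<in> ball 0 1 \<Longrightarrow>
         eta_tr (\<rho> (s + t)) z = eta_tr (\<rho> t) z * h_tr (\<rho> s) (f t z)" for \<rho>
  proof
    fix s t :: real and z :: complex
    show "continuous_on ({0..} \<times> ball 0 1) (\<lambda>(t, z). h_tr (\<rho> t) z)"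
      by (rule continuous_on_h_tr_joint[OF w \<rho>])
    show h: "h_tr (\<rho> t) holomorphic_on ball 0 1" if "0 \<le> t" for t
      by (rule holomorphic_h_tr[OF \<rho>[OF that]])
    assume z: "z \<in> ball 0 1"
    show "h_tr (\<rho> 0) z = 1" using z by (simp add: \<rho>0 h_tr_delta1)
    assume st: "0 \<le> s" "0 \<le> t"
    \<comment> \<open>The identity for \<open>eta_tr\<close> carries a factor \<open>z\<close>, so
      it yields the one for \<open>h_tr\<close> only away from 0; continuity of the holomorphic
      defect \<open>d\<close> covers the origin.\<close>
    define d where "d z = h_tr (\<rho> (s + t)) z - h_tr (\<rho> t) z * h_tr (\<rho> s) (f t z)" for z
    have d0: "d z = 0" if "z \<in> ball 0 1 - {0}" for z
      using conv[OF st, of z] that st \<rho> by (simp add: d_def eta_tr_eq_h_tr)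
    have "(\<lambda>z. h_tr (\<rho> s) (f t z)) holomorphic_on ball 0 1"
      using holomorphic_on_compose_gen[OF F.holo[OF st(2)] h[OF st(1)]] maps[OF st(2)]
      by (simp add: o_def image_subset_iff)
    then have "d holomorphic_on ball 0 1"
      unfolding d_def using st by (intro holomorphic_intros h) auto
    then have "isCont d 0"
      by (auto dest!: holomorphic_on_imp_continuous_on simp: continuous_on_eq_continuous_at)
    then have "d \<midarrow>0\<rightarrow> d 0" by (simp add: isCont_def)
    moreover have "\<forall>\<^sub>F z in at 0. d z = 0"
      unfolding eventually_at by (rule exI[of _ 1]) (use d0 in auto)
    then have "d \<midarrow>0\<rightarrow> 0" by (simp add: tendsto_eventually)
    ultimately have "d 0 = 0" using LIM_unique by blast
    then have "d z = 0" using d0 z by (cases "z = 0") auto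
    then show "h_tr (\<rho> (s + t)) z = h_tr (\<rho> t) z * h_tr (\<rho> s) (f t z)" by (simp add: d_def)
  qed
  interpret M: disc_cocycle f "\<lambda>t. h_tr (\<mu> t)"
    by (rule cocycle) (use p\<mu> w\<mu> \<mu>0 conv in \<open>auto simp: f_def\<close>)
  interpret N: disc_cocycle f "\<lambda>t. h_tr (\<nu> t)"
  proof (rule cocycle)
    fix s t :: real and z :: complex assume *: "0 \<le> s" "0 \<le> t" "z \<in> ball 0 1"
    \<comment> \<open>For \<open>\<nu>\<close> the composition law becomes a cocycle law by writing
      \<open>f s w\<close> as \<open>w * h_tr (\<nu> s) w\<close> at
      \<open>w = f t z\<close>.\<close>
    show "eta_tr (\<nu> (s + t)) z = eta_tr (\<nu> t) z * h_tr (\<nu> s) (f t z)"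
      using conv(1)[OF *] fz[OF *(1) maps[OF *(2,3)]] by (simp add: f_def)
  qed (use p\<nu> w\<nu> \<nu>0 in auto)
  have "admissible_B M.cocycle_generator"
    unfolding admissible_B_def unit_disc_def
    using M.holomorphic_cocycle_generator M.Re_cocycle_generator_nonpos norm_eta_tr_le(2)[OF p\<mu>] by auto
  moreover have "admissible_B N.cocycle_generator"
    unfolding admissible_B_def unit_disc_def
    using N.holomorphic_cocycle_generator N.Re_cocycle_generator_nonpos norm_eta_tr_le(2)[OF p\<nu>] by auto
  \<comment> \<open>Multiplying the equation for \<open>h_tr\<close> by the constant
    \<open>z\<close> gives the one for \<open>eta_tr\<close>, with the same generator.\<close>
  moreover have "((\<lambda>s. eta_tr (\<rho> s) z) has_vector_derivative eta_tr (\<rho> t) z * b) (at t within {0..})"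
    if "0 \<le> t" "z \<in> ball 0 1" "\<And>t. 0 \<le> t \<Longrightarrow> prob_T (\<rho> t)"
      and D: "((\<lambda>s. h_tr (\<rho> s) z) has_vector_derivative h_tr (\<rho> t) z * b) (at t within {0..})"
    for \<rho> t z b
  proof -
    have "((\<lambda>s. z * h_tr (\<rho> s) z) has_vector_derivative z * (h_tr (\<rho> t) z * b)) (at t within {0..})"
      by (rule has_vector_derivative_mult_right[OF D])
    then have "((\<lambda>s. eta_tr (\<rho> s) z) has_vector_derivative z * (h_tr (\<rho> t) z * b)) (at t within {0..})"
      by (rule has_vector_derivative_transform[rotated 2]) (use that in \<open>auto simp: eta_tr_eq_h_tr\<close>)
    then show ?thesis using that by (simp add: eta_tr_eq_h_tr mult.assoc)
  qed
  then have "cmc_ode \<mu> \<nu> M.cocycle_generator N.cocycle_generator"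
    unfolding cmc_ode_def unit_disc_def
    using M.cocycle_generator_ode N.cocycle_generator_ode p\<mu> p\<nu> by (auto simp: f_def)
  ultimately show ?thesis by blast
qed

section \<open>Herglotz representation\<close>

text \<open>The parametrisation behind \<open>circlepath 0 1\<close>: contour integrals become
  averages over the unit interval, that is, over normalised arc length.\<close>

definition circ :: "real \<Rightarrow> complex" where
  "circ x = exp (2 * of_real pi * \<i> * of_real x)"

lemma norm_circ [simp]: "norm (circ x) = 1"
  by (simp add: circ_def norm_exp_eq_Re)

lemma circ_nonzero [simp]: "circ x \<noteq> 0"
  by (simp add: circ_def)

lemma cnj_unit: "norm \<zeta> = 1 \<Longrightarrow> cnj \<zeta> = 1 / \<zeta>"
  using complex_norm_square[of \<zeta>] by (cases "\<zeta> = 0") (auto simp: field_simps)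

lemma continuous_on_circ [continuous_intros]: "continuous_on S circ"
  unfolding circ_def by (intro continuous_intros)

lemma circ_neq: "norm z < 1 \<Longrightarrow> circ x \<noteq> z"
  using norm_circ[of x] by auto

text \<open>The factor \<open>circ x\<close> comes from the derivative
  \<open>2 * pi * \<i> * circ x\<close> of the parametrisation, whose constant cancels the one in
  Cauchy's formula.\<close>

lemma has_integral_cauchy_circ:
  assumes "f holomorphic_on cball 0 1" "norm z < 1"
  shows "((\<lambda>x. f (circ x) * circ x / (circ x - z)) has_integral f z) {0..1}"
proof -
  have "((\<lambda>u. f u / (u - z)) has_contour_integral (2 * of_real pi * \<i> * f z)) (circlepath 0 1)"
    using Cauchy_integral_circlepath_simple[of f 0 1 z] assms by simp
  then have "((\<lambda>x. f (circ x) / (circ x - z) * (2 * pi * \<i> * circ x)) has_integral 2 * of_real pi * \<i> * f z) {0..1}"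
    unfolding has_contour_integral vector_derivative_circlepath by (simp add: circlepath circ_def)
  then have "((\<lambda>x. 1 / (2 * of_real pi * \<i>) * (f (circ x) / (circ x - z) * (2 * pi * \<i> * circ x)))
     has_integral 1 / (2 * of_real pi * \<i>) * (2 * of_real pi * \<i> * f z)) {0..1}"
    by (rule has_integral_mult_right)
  then show ?thesis by (simp add: field_simps)
qed

text \<open>The real part is half the sum of \<open>g\<close> and its conjugate. Against
  \<open>g\<close> the kernel is \<open>2 * circ x / (circ x - z) - 1\<close>, so Cauchy's formula
  gives \<open>2 * g z - g 0\<close>; the conjugate contributes \<open>cnj (g 0)\<close>.\<close>

lemma has_integral_schwarz_circ:
  assumes g: "g holomorphic_on cball 0 1" and z: "norm z < 1"
  shows "((\<lambda>x. of_real (Re (g (circ x))) * ((circ x + z) / (circ x - z))) has_integral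
     g z - \<i> * of_real (Im (g 0))) {0..1}"
proof -
  have I1: "((\<lambda>x. 2 * (g (circ x) * circ x / (circ x - z)) - g (circ x) * circ x / (circ x - 0)) has_integral
      2 * g z - g 0) {0..1}"
    by (intro has_integral_diff has_integral_mult_right has_integral_cauchy_circ g z) auto
  have e1: "2 * (g (circ x) * circ x / (circ x - z)) - g (circ x) * circ x / (circ x - 0)
      = g (circ x) * ((circ x + z) / (circ x - z))" for x
  proof -
    have "circ x - z \<noteq> 0" using circ_neq[OF z, of x] by simp
    then show ?thesis by (simp add: field_simps)
  qed
  \<comment> \<open>On the circle the second factor is the conjugate of the Schwarz kernel. It is
    holomorphic on the closed disc and equals 1 at 0, so the mean value of \<open>?k\<close> is
    \<open>g 0\<close>.\<close>
  let ?k = "\<lambda>w. g w * ((1 + cnj z * w) / (1 - cnj z * w))"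
  have "cnj z * w \<noteq> 1" if "norm w \<le> 1" for w
  proof -
    have "norm (cnj z * w) \<le> norm z" using that by (simp add: norm_mult mult_left_le)
    then show ?thesis using z by auto
  qed
  then have "?k holomorphic_on cball 0 1"
    by (intro holomorphic_intros g) auto
  then have "((\<lambda>x. ?k (circ x) * circ x / (circ x - 0)) has_integral ?k 0) {0..1}"
    by (rule has_integral_cauchy_circ) simp
  then have I2: "(cnj \<circ> (\<lambda>x. ?k (circ x)) has_integral cnj (g 0)) {0..1}"
    unfolding has_integral_cnj by simp
  have e2: "(cnj \<circ> (\<lambda>x. ?k (circ x))) x = cnj (g (circ x)) * ((circ x + z) / (circ x - z))" for x
  proof -
    have "(1 + z * (1 / circ x)) / (1 - z * (1 / circ x)) = (circ x + z) / (circ x - z)"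
      using circ_neq[OF z, of x] by (simp add: field_simps)
    then show ?thesis by (simp only: o_def cnj_unit[OF norm_circ] complex_cnj_mult complex_cnj_divide
          complex_cnj_add complex_cnj_diff complex_cnj_cnj complex_cnj_one)
  qed
  have "((\<lambda>x. 1/2 * (g (circ x) * ((circ x + z) / (circ x - z)) + cnj (g (circ x)) * ((circ x + z) / (circ x - z))))
      has_integral 1/2 * ((2 * g z - g 0) + cnj (g 0))) {0..1}"
    using I1 I2 unfolding e1 e2[abs_def] o_def[symmetric]
    by (intro has_integral_mult_right has_integral_add) (simp_all add: e2[unfolded o_def] o_def)
  moreover have "1/2 * ((2 * g z - g 0) + cnj (g 0)) = g z - \<i> * of_real (Im (g 0))"
    by (simp add: complex_eq_iff)
  moreover have "1/2 * (g w * u + cnj (g w) * u) = of_real (Re (g w)) * u" for w u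
    by (simp flip: distrib_right add: complex_add_cnj)
  ultimately show ?thesis by (simp only:)
qed

section \<open>Densities on the circle and the Herglotz measure\<close>

lemma measurable_circ: "circ \<in> borel \<rightarrow>\<^sub>M circle_borel"
  unfolding circle_borel_def
  by (intro measurable_restrict_space2 borel_measurable_continuous_onI continuous_intros) auto

lemma herglotz_kernel_continuous:
  "norm z < 1 \<Longrightarrow> continuous_on (sphere 0 1) (\<lambda>\<zeta>::complex. (z + \<zeta>) / (z - \<zeta>))"
  by (intro continuous_intros) auto

text \<open>Kept as a measure on the whole line, since tightness and Helly selection concern
  distributions on the reals.\<close>

definition circ_density :: "(real \<Rightarrow> real) \<Rightarrow> real measure" where
  "circ_density p = density lborel (\<lambda>x. ennreal (indicator {0..1} x * p x))"

lemma
  fixes p :: "real \<Rightarrow> real"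
  assumes c: "continuous_on UNIV p" and nn: "\<And>x. 0 \<le> p x" and I: "(p has_integral 1) {0..1}"
  shows real_distribution_circ_density: "real_distribution (circ_density p)"
    and measure_circ_density: "measure (circ_density p) {-1<..1} = 1"
    and integral_circ_density: "\<And>\<phi> :: real \<Rightarrow> complex. continuous_on UNIV \<phi> \<Longrightarrow>
          integral\<^sup>L (circ_density p) \<phi> = integral {0..1} (\<lambda>x. of_real (p x) * \<phi> x)"
proof -
  have m: "p \<in> borel_measurable borel" using c by (rule borel_measurable_continuous_onI)
  have "((\<lambda>x. indicator {0..1} x * p x) has_integral 1) UNIV"
    using I unfolding has_integral_restrict_UNIV[of "{0..1}", symmetric]
    by (rule has_integral_eq[rotated]) (auto simp: indicator_def)
  then have one: "(\<integral>\<^sup>+x. ennreal (indicator {0..1} x * p x) \<partial>lborel) = 1"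
    using nn_integral_has_integral_lborel[of "\<lambda>x. indicator {0..1} x * p x" 1] m nn by simp
  have em: "emeasure (circ_density p) A = 1" if "A \<in> sets borel" "{0..1} \<subseteq> A" for A
  proof -
    have "emeasure (circ_density p) A = (\<integral>\<^sup>+x. ennreal (indicator {0..1} x * p x) * indicator A x \<partial>lborel)"
      unfolding circ_density_def using m that by (intro emeasure_density) auto
    also have "\<dots> = (\<integral>\<^sup>+x. ennreal (indicator {0..1} x * p x) \<partial>lborel)"
      using that by (intro nn_integral_cong) (auto simp: indicator_def)
    finally show ?thesis using one by simp
  qed
  have "prob_space (circ_density p)"
    by (rule prob_spaceI) (use em[of UNIV] in \<open>simp add: circ_density_def\<close>)
  then show "real_distribution (circ_density p)"
    unfolding real_distribution_def real_distribution_axioms_def by (simp add: circ_density_def)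
  \<comment> \<open>The left end \<open>-1\<close> keeps 0 inside a half-open interval, the shape in
    which tightness is stated.\<close>
  have "emeasure (circ_density p) {-1<..1} = 1" by (rule em) auto
  then show "measure (circ_density p) {-1<..1} = 1" by (simp add: measure_def)
  fix \<phi> :: "real \<Rightarrow> complex" assume \<phi>: "continuous_on UNIV \<phi>"
  have "integral\<^sup>L (circ_density p) \<phi> = (LBINT x. (indicator {0..1} x * p x) *\<^sub>R \<phi> x)"
    unfolding circ_density_def
    using m nn \<phi> by (intro integral_density) (auto intro: borel_measurable_continuous_onI)
  also have "\<dots> = (LBINT x:{0..1}. of_real (p x) * \<phi> x)"
    by (simp add: set_lebesgue_integral_def scaleR_conv_of_real mult.assoc)
  also have "\<dots> = integral {0..1} (\<lambda>x. of_real (p x) * \<phi> x)"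
    by (intro set_borel_integral_eq_integral borel_integrable_atLeastAtMost' continuous_intros
          continuous_on_subset[OF \<phi>] continuous_on_subset[OF c]) auto
  finally show "integral\<^sup>L (circ_density p) \<phi> = integral {0..1} (\<lambda>x. of_real (p x) * \<phi> x)" .
qed

text \<open>Helly selection is applied to the pull-backs of the measures to the unit interval.
  The limit measure need not be inspected there: it is pushed forward to the circle.\<close>
lemma herglotz_representation:
  assumes B: "admissible_B B"
  shows "\<exists>(\<gamma>::real) \<tau>. finite_meas_T \<tau> \<and>
          (\<forall>z\<in>unit_disc. B z = \<i> * complex_of_real \<gamma> + (\<integral>\<zeta>. (z + \<zeta>) / (z - \<zeta>) \<partial>\<tau>))"
proof -
  have hB: "B holomorphic_on ball 0 1" and Re: "\<And>z. norm z < 1 \<Longrightarrow> Re (B z) \<le> 0"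
    using B by (auto simp: admissible_B_def unit_disc_def)
  \<comment> \<open>Radii below 1 make the dilates \<open>g n\<close> holomorphic on the closed
    disc, so that the Schwarz formula applies; as the radii tend to 1, \<open>g n\<close> converges
    pointwise to \<open>B\<close>.\<close>
  define r :: "nat \<Rightarrow> real" where "r n = 1 - 1 / (real n + 2)" for n
  have r: "0 \<le> r n" "r n < 1" for n by (auto simp: r_def field_simps)
  have r_lim: "r \<longlonglongrightarrow> 1" unfolding r_def by real_asymp
  define g where "g n z = B (of_real (r n) * z)" for n z
  have rz: "norm (of_real (r n) * z) < 1" if "norm z \<le> 1" for n and z :: complex
  proof -
    have "norm (of_real (r n) * z) \<le> r n" using r[of n] that by (simp add: norm_mult mult_left_le)
    then show ?thesis using r(2)[of n] by linarith
  qed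
  have hg: "g n holomorphic_on cball 0 1" for n
    unfolding g_def using rz
    by (intro holomorphic_on_compose_gen[OF _ hB, unfolded o_def]) (auto intro!: holomorphic_intros)
  have g_lim: "(\<lambda>n. g n z) \<longlonglongrightarrow> B z" if "norm z < 1" for z
  proof -
    have "isCont B z" using hB that
      by (auto dest!: holomorphic_on_imp_continuous_on simp: continuous_on_eq_continuous_at)
    moreover have "(\<lambda>n. of_real (r n) * z) \<longlonglongrightarrow> of_real 1 * z" by (intro tendsto_intros r_lim)
    ultimately show ?thesis unfolding g_def by (intro isCont_tendsto_compose[of z B]) auto
  qed
  have g0: "g n 0 = B 0" for n by (simp add: g_def)
  define \<gamma> where "\<gamma> = Im (B 0)"
  \<comment> \<open>The total mass of the measure to be found.\<close>
  define c where "c = - Re (B 0)"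
  have schwarz: "((\<lambda>x. of_real (Re (g n (circ x))) * ((circ x + z) / (circ x - z))) has_integral
     g n z - \<i> * of_real \<gamma>) {0..1}" if "norm z < 1" for n z
    using has_integral_schwarz_circ[OF hg[of n] that] by (simp add: g0 \<gamma>_def)
  show ?thesis
  proof (cases "c = 0")
    case True
    \<comment> \<open>Normalising by \<open>c\<close> is impossible here. But
      \<open>|exp B| = exp (Re B)\<close> attains its maximum 1 at 0, so \<open>exp B\<close> is
      constant, \<open>Re B\<close> vanishes, the Schwarz formula makes \<open>B\<close> an
      imaginary constant, and the null measure serves.\<close>
    have "(\<lambda>z. exp (B z)) constant_on ball 0 1"
      by (rule maximum_modulus_principle[where U = "ball 0 1" and \<xi> = 0])
         (use hB Re True in \<open>auto intro!: holomorphic_intros simp: c_def norm_exp_eq_Re\<close>)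
    then obtain k where k: "\<And>z. z \<in> ball 0 1 \<Longrightarrow> exp (B z) = k" by (auto simp: constant_on_def)
    have Re0: "Re (B z) = 0" if "norm z < 1" for z
    proof -
      have "exp (Re (B z)) = norm k" using k[of z] that by (metis mem_ball_0 norm_exp_eq_Re)
      moreover have "exp (Re (B 0)) = norm k" using k[of 0] by (metis mem_ball_0 norm_exp_eq_Re norm_zero zero_less_one)
      ultimately show ?thesis using True by (simp add: c_def)
    qed
    have "g n z = \<i> * of_real \<gamma>" if "norm z < 1" for n z
      using schwarz[OF that, of n] Re0[OF rz] by (simp add: g_def)
    then have "B z = \<i> * of_real \<gamma>" if "norm z < 1" for z
      using g_lim[OF that] that by (simp add: LIMSEQ_const_iff)
    moreover have "finite_meas_T (null_measure circle_borel)"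
      by (auto simp: finite_meas_T_def intro!: finite_measureI)
    ultimately show ?thesis
      by (intro exI[of _ \<gamma>] exI[of _ "null_measure circle_borel"]) (auto simp: unit_disc_def)
  next
    case False
    then have c: "c > 0" using Re[of 0] by (simp add: c_def)
    \<comment> \<open>Normalised densities from the boundary values of the dilates; the Schwarz
      formula at \<open>z = 0\<close> gives them mass 1.\<close>
    define p where "p n x = - Re (g n (circ x)) / c" for n x
    have pc: "continuous_on UNIV (p n)" for n
    proof -
      have "continuous_on UNIV (\<lambda>x. g n (circ x))"
        by (rule continuous_on_compose2[OF holomorphic_on_imp_continuous_on[OF hg]])
           (auto intro!: continuous_intros)
      then show ?thesis unfolding p_def using c by (intro continuous_intros) auto
    qed
    have pnn: "0 \<le> p n x" for n x
      using Re[OF rz, of "circ x" n] c by (simp add: p_def g_def divide_nonpos_pos)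
    have pz: "((\<lambda>x. of_real (p n x) * ((circ x + z) / (circ x - z))) has_integral
        (\<i> * of_real \<gamma> - g n z) / of_real c) {0..1}" if "norm z < 1" for n z
    proof -
      have "of_real (p n x) * u = (- 1 / of_real c) * (of_real (Re (g n (circ x))) * u)" for x and u :: complex
        by (simp add: p_def)
      moreover have "(\<i> * of_real \<gamma> - g n z) / of_real c = (- 1 / of_real c) * (g n z - \<i> * of_real \<gamma>)"
        using c by (simp add: field_simps)
      ultimately show ?thesis
        using has_integral_mult_right[OF schwarz[OF that, of n], of "- 1 / of_real c"] by (simp only:)
    qed
    have p1: "(p n has_integral 1) {0..1}" for n
    proof -
      have "((\<lambda>x. of_real (p n x)) has_integral (\<i> * of_real \<gamma> - B 0) / of_real c) {0..1}"
        using pz[of 0 n] by (simp add: g0)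
      from has_integral_Re[OF this] show ?thesis using c by (simp add: c_def Re_divide_of_real)
    qed
    note M = real_distribution_circ_density[OF pc pnn p1]
    have "tight (\<lambda>n. circ_density (p n))"
      unfolding tight_def
    proof (intro conjI allI impI M)
      fix \<epsilon> :: real assume "\<epsilon> > 0"
      then show "\<exists>a b. a < b \<and> (\<forall>n. 1 - \<epsilon> < measure (circ_density (p n)) {a<..b})"
        by - (rule exI[of _ "-1"], rule exI[of _ 1], simp add: measure_circ_density[OF pc pnn p1])
    qed
    from tight_imp_convergent_subsubsequence[OF this strict_mono_id]
    obtain s N where s: "strict_mono s" and N: "real_distribution N"
      and wc: "weak_conv_m (\<lambda>n. circ_density (p (s n))) N"
      by (auto simp: o_def)
    have lim: "(\<integral>x. (circ x + z) / (circ x - z) \<partial>N) = (\<i> * of_real \<gamma> - B z) / of_real c"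
      if z: "norm z < 1" for z
    proof -
      let ?\<phi> = "\<lambda>x. (circ x + z) / (circ x - z)"
      have \<phi>: "continuous_on UNIV ?\<phi>"
        using circ_neq[OF z] by (intro continuous_intros) auto
      have "norm (?\<phi> x) \<le> 2 / (1 - norm z)" for x
      proof -
        have "norm (circ x + z) \<le> 2" using norm_triangle_ineq[of "circ x" z] z by simp
        moreover have "norm (circ x - z) \<ge> 1 - norm z" using norm_triangle_ineq2[of "circ x" z] by simp
        ultimately show ?thesis using z by (simp add: norm_divide frac_le)
      qed
      with weak_conv_imp_integral_bdd_continuous_conv[OF M N wc, of ?\<phi>] \<phi>
      have "(\<lambda>n. integral\<^sup>L (circ_density (p (s n))) ?\<phi>) \<longlonglongrightarrow> integral\<^sup>L N ?\<phi>"
        by (auto simp: continuous_on_eq_continuous_at)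
      moreover have "integral\<^sup>L (circ_density (p (s n))) ?\<phi> = (\<i> * of_real \<gamma> - g (s n) z) / of_real c" for n
        using integral_circ_density[OF pc pnn p1 \<phi>] integral_unique[OF pz[OF z]] by simp
      moreover have "(\<lambda>n. (\<i> * of_real \<gamma> - g (s n) z) / of_real c) \<longlonglongrightarrow> (\<i> * of_real \<gamma> - B z) / of_real c"
        using LIMSEQ_subseq_LIMSEQ[OF g_lim[OF z] s] c by (intro tendsto_intros) (auto simp: o_def)
      ultimately show ?thesis by (simp add: LIMSEQ_unique)
    qed
    interpret N: real_distribution N by (rule N)
    have mN: "circ \<in> N \<rightarrow>\<^sub>M circle_borel"
      using measurable_circ by (simp add: measurable_cong_sets[OF N.events_eq_borel refl])
    \<comment> \<open>Multiplication by \<open>c\<close> undoes the normalisation. The minus sign in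
      \<open>p\<close> matches the kernel \<open>(z + \<zeta>) / (z - \<zeta>)\<close>, which is
      minus the Schwarz kernel.\<close>
    define \<tau> where "\<tau> = density (distr N circle_borel circ) (\<lambda>_. ennreal c)"
    have "finite_meas_T \<tau>"
      unfolding finite_meas_T_def
    proof
      interpret D: prob_space "distr N circle_borel circ" by (rule N.prob_space_distr[OF mN])
      show "finite_measure \<tau>"
        by (rule finite_measureI)
           (simp add: \<tau>_def emeasure_density D.emeasure_space_1[unfolded space_distr] nn_integral_cmult ennreal_mult_eq_top_iff D.emeasure_space_1)
    qed (simp add: \<tau>_def)
    moreover have "B z = \<i> * of_real \<gamma> + (\<integral>\<zeta>. (z + \<zeta>) / (z - \<zeta>) \<partial>\<tau>)" if z: "norm z < 1" for z
    proof -
      have km: "(\<lambda>\<zeta>. (z + \<zeta>) / (z - \<zeta>)) \<in> borel_measurable circle_borel"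
        unfolding circle_borel_def
        by (intro borel_measurable_continuous_on_restrict herglotz_kernel_continuous z)
      have "(\<integral>\<zeta>. (z + \<zeta>) / (z - \<zeta>) \<partial>\<tau>) = (\<integral>\<zeta>. c *\<^sub>R ((z + \<zeta>) / (z - \<zeta>)) \<partial>distr N circle_borel circ)"
        unfolding \<tau>_def using km c by (intro integral_density) auto
      also have "\<dots> = c *\<^sub>R (\<integral>x. (z + circ x) / (z - circ x) \<partial>N)"
        by (simp add: integral_distr[OF mN km])
      also have "(\<lambda>x. (z + circ x) / (z - circ x)) = (\<lambda>x. - ((circ x + z) / (circ x - z)))"
        by (metis (no_types, opaque_lifting) add.commute minus_diff_eq minus_divide_right)
      finally show ?thesis using lim[OF z] c by (simp add: scaleR_conv_of_real)
    qed
    ultimately show ?thesis by (intro exI[of _ \<gamma>] exI[of _ \<tau>]) (auto simp: unit_disc_def)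
  qed
qed

text \<open>The Cayley transform \<open>- (1 + \<eta>) / (1 - \<eta>)\<close> is admissible, and
  since \<open>1 + psi = 1 / (1 - eta)\<close>, its Herglotz measure yields the measure sought after
  a reflection.\<close>

lemma exists_prob_T_eta_tr:
  assumes h: "\<eta> holomorphic_on ball 0 1" and le: "\<And>z. norm z < 1 \<Longrightarrow> norm (\<eta> z) \<le> norm z"
  shows "\<exists>\<mu>. prob_T \<mu> \<and> (\<forall>z\<in>ball 0 1. eta_tr \<mu> z = \<eta> z)"
proof -
  have lt: "norm (\<eta> z) < 1" if "norm z < 1" for z using le[OF that] that by linarith
  then have n1: "\<eta> z \<noteq> 1" if "norm z < 1" for z using that by fastforce
  define B where "B z = - ((1 + \<eta> z) / (1 - \<eta> z))" for z
  have "admissible_B B"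
    unfolding admissible_B_def unit_disc_def
  proof (intro conjI ballI)
    show "B holomorphic_on ball 0 1"
      unfolding B_def using n1 by (intro holomorphic_intros h) auto
    fix z :: complex assume z: "z \<in> ball 0 1"
    have "norm (\<eta> z) ^ 2 \<le> 1" using lt[of z] z by (simp add: power_le_one)
    then have "(Re (\<eta> z))^2 + (Im (\<eta> z))^2 \<le> 1" by (simp add: cmod_power2)
    then have "(1 + Re (\<eta> z)) * (1 - Re (\<eta> z)) - Im (\<eta> z) * Im (\<eta> z) \<ge> 0"
      by (simp add: power2_eq_square algebra_simps)
    then show "Re (B z) \<le> 0"
      by (simp add: B_def Re_divide divide_nonneg_nonneg)
  qed
  from herglotz_representation[OF this]
  obtain \<gamma> :: real and \<tau> where \<tau>: "finite_meas_T \<tau>"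
    and rep: "\<And>z. norm z < 1 \<Longrightarrow> B z = \<i> * of_real \<gamma> + (\<integral>\<zeta>. (z + \<zeta>) / (z - \<zeta>) \<partial>\<tau>)"
    by (auto simp: unit_disc_def)
  interpret F: finite_measure \<tau> using \<tau> by (simp add: finite_meas_T_def)
  have sp: "space \<tau> = sphere 0 1" by (rule space_finite_meas_T[OF \<tau>])
  have "\<eta> 0 = 0" using le[of 0] by simp
  \<comment> \<open>Evaluation at 0, where \<open>\<eta>\<close> vanishes, forces
    \<open>\<gamma> = 0\<close> and total mass 1.\<close>
  then have "-1 = \<i> * of_real \<gamma> + (\<integral>\<zeta>. (0 + \<zeta>) / (0 - \<zeta>) \<partial>\<tau>)"
    using rep[of 0] by (simp add: B_def)
  also have "(\<integral>\<zeta>. (0 + \<zeta>) / (0 - \<zeta>) \<partial>\<tau>) = (\<integral>\<zeta>. -1 \<partial>\<tau>)"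
    by (rule Bochner_Integration.integral_cong) (auto simp: sp)
  finally have e0: "-1 = \<i> * of_real \<gamma> - of_real (measure \<tau> (space \<tau>))" by (simp add: scaleR_conv_of_real)
  have \<gamma>0: "\<gamma> = 0" and m1: "measure \<tau> (space \<tau>) = 1"
    using arg_cong[OF e0, of Im] arg_cong[OF e0, of Re] by auto
  then interpret P: prob_space \<tau> by (intro prob_spaceI) (simp add: F.emeasure_eq_measure)
  have mc: "cnj \<in> \<tau> \<rightarrow>\<^sub>M circle_borel"
  proof -
    have "cnj \<in> circle_borel \<rightarrow>\<^sub>M circle_borel"
      unfolding circle_borel_def
      by (intro measurable_restrict_space2 borel_measurable_continuous_on_restrict continuous_intros)
         (auto simp: space_restrict_space)
    then show ?thesis using \<tau> by (metis finite_meas_T_def measurable_cong_sets)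
  qed
  \<comment> \<open>On the circle \<open>(z + \<zeta>) / (z - \<zeta>) = 1 - 2 / (1 - z * cnj
    \<zeta>)\<close>, while the transforms use \<open>1 - z * \<zeta>\<close>; hence the
    push-forward by conjugation.\<close>
  define \<mu> where "\<mu> = distr \<tau> circle_borel cnj"
  have \<mu>: "prob_T \<mu>"
    unfolding prob_T_def \<mu>_def using P.prob_space_distr[OF mc] by simp
  have "eta_tr \<mu> z = \<eta> z" if z: "norm z < 1" for z
  proof -
    have k: "continuous_on (sphere 0 1) (\<lambda>\<zeta>. 1 / (1 - z * \<zeta>))"
      using z by (intro continuous_intros) (auto simp: disc_kernel_nonzero)
    have "cauchy_moment \<mu> 0 z = (\<integral>\<zeta>. 1 / (1 - z * cnj \<zeta>) \<partial>\<tau>)"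
      unfolding cauchy_moment_def \<mu>_def
      using integral_distr[OF mc borel_measurable_continuous_on_restrict[OF k, folded circle_borel_def]] by simp
    moreover have "(\<integral>\<zeta>. (z + \<zeta>) / (z - \<zeta>) \<partial>\<tau>) = (\<integral>\<zeta>. 1 - 2 * (1 / (1 - z * cnj \<zeta>)) \<partial>\<tau>)"
    proof (rule Bochner_Integration.integral_cong)
      fix \<zeta> assume "\<zeta> \<in> space \<tau>"
      then have \<zeta>: "norm \<zeta> = 1" by (simp add: sp)
      then have c: "cnj \<zeta> = 1 / \<zeta>" by (rule cnj_unit)
      have "\<zeta> \<noteq> 0" "\<zeta> \<noteq> z" using \<zeta> z by auto
      then show "(z + \<zeta>) / (z - \<zeta>) = 1 - 2 * (1 / (1 - z * cnj \<zeta>))"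
        unfolding c by (simp add: divide_simps) (simp add: algebra_simps)
    qed simp
    moreover have "integrable \<tau> (\<lambda>\<zeta>. 1 / (1 - z * cnj \<zeta>))"
      using z by (intro integrable_finite_meas_T[OF \<tau>] continuous_intros) (auto simp: disc_kernel_nonzero)
    then have "(\<integral>\<zeta>. 1 - 2 * (1 / (1 - z * cnj \<zeta>)) \<partial>\<tau>) = 1 - 2 * (\<integral>\<zeta>. 1 / (1 - z * cnj \<zeta>) \<partial>\<tau>)"
      using Bochner_Integration.integral_diff[of \<tau> "\<lambda>_. 1" "\<lambda>\<zeta>. 2 * (1 / (1 - z * cnj \<zeta>))"]
        integrable_mult_right[of 2 \<tau> "\<lambda>\<zeta>. 1 / (1 - z * cnj \<zeta>)"]
        integral_mult_right_zero[of \<tau> 2 "\<lambda>\<zeta>. 1 / (1 - z * cnj \<zeta>)"]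
      by (simp only: P.prob_space F.integrable_const lebesgue_integral_const scaleR_one)
    ultimately have "- ((1 + \<eta> z) / (1 - \<eta> z)) = 1 - 2 * cauchy_moment \<mu> 0 z"
      using rep[OF z] by (simp add: B_def \<gamma>0)
    moreover have "1 + (1 + \<eta> z) / (1 - \<eta> z) = 2 * (1 / (1 - \<eta> z))"
      using n1[OF z] by (simp add: field_simps)
    ultimately have "2 * cauchy_moment \<mu> 0 z = 2 * (1 / (1 - \<eta> z))"
      by (simp add: algebra_simps)
    then have "cauchy_moment \<mu> 0 z = 1 / (1 - \<eta> z)"
      by (simp only: mult_cancel_left) simp
    then have "1 + psi_tr \<mu> z = 1 / (1 - \<eta> z)" using one_plus_psi_tr(1)[OF \<mu> z] by simp
    moreover from this have "psi_tr \<mu> z = \<eta> z / (1 - \<eta> z)"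
      using n1[OF z] by (simp add: field_simps eq_diff_eq)
    ultimately show ?thesis unfolding eta_tr_def using n1[OF z] by simp
  qed
  then show ?thesis using \<mu> by auto
qed

section \<open>Weak continuity from transforms\<close>

text \<open>A recursion that reaches all orders from \<open>k = 0\<close>: for nonzero
  \<open>z\<close>, order \<open>Suc k\<close> is a difference quotient of order
  \<open>k\<close>.\<close>

lemma cauchy_moment_Suc:
  assumes \<mu>: "prob_T \<mu>" and z: "norm z < 1"
  shows "cauchy_moment \<mu> k z - cauchy_moment \<mu> k 0 = z * cauchy_moment \<mu> (Suc k) z"
proof -
  note i = integrable_finite_meas_T[OF finite_meas_T_if_prob_T[OF \<mu>]]
  have "cauchy_moment \<mu> k z - cauchy_moment \<mu> k 0 = (\<integral>\<zeta>. \<zeta> ^ k / (1 - z * \<zeta>) - \<zeta> ^ k / (1 - 0 * \<zeta>) \<partial>\<mu>)"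
    unfolding cauchy_moment_def
    by (intro Bochner_Integration.integral_diff[symmetric] i)
       (use z in \<open>auto intro!: continuous_intros simp: disc_kernel_nonzero\<close>)
  also have "\<dots> = (\<integral>\<zeta>. z * (\<zeta> ^ Suc k / (1 - z * \<zeta>)) \<partial>\<mu>)"
  proof (intro Bochner_Integration.integral_cong refl)
    fix \<zeta> assume "\<zeta> \<in> space \<mu>"
    then have "1 - z * \<zeta> \<noteq> 0"
      using space_finite_meas_T[OF finite_meas_T_if_prob_T[OF \<mu>]] z by (auto simp: disc_kernel_nonzero)
    then show "\<zeta> ^ k / (1 - z * \<zeta>) - \<zeta> ^ k / (1 - 0 * \<zeta>) = z * (\<zeta> ^ Suc k / (1 - z * \<zeta>))"
      by (simp add: field_simps)
  qed
  finally show ?thesis unfolding cauchy_moment_def by (simp only: integral_mult_right_zero)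
qed

lemma norm_cauchy_moment_le:
  assumes \<mu>: "prob_T \<mu>" and z: "norm z < 1"
  shows "norm (cauchy_moment \<mu> k z) \<le> 1 / (1 - norm z)"
  unfolding cauchy_moment_def
proof (rule norm_integral_prob_T_le[OF \<mu>])
  show "continuous_on (sphere 0 1) (\<lambda>\<zeta>. \<zeta> ^ k / (1 - z * \<zeta>))"
    using z by (intro continuous_intros) (auto simp: disc_kernel_nonzero)
  fix \<zeta> :: complex assume "\<zeta> \<in> sphere 0 1"
  then have \<zeta>: "norm \<zeta> = 1" by simp
  have "1 - norm z \<le> norm (1 - z * \<zeta>)"
    using norm_triangle_ineq2[of 1 "z * \<zeta>"] \<zeta> by (simp add: norm_mult)
  then show "norm (\<zeta> ^ k / (1 - z * \<zeta>)) \<le> 1 / (1 - norm z)"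
    using \<zeta> z by (simp add: norm_divide norm_power frac_le)
qed

text \<open>The case \<open>k = 0\<close> is \<open>1 / (1 - eta)\<close>, and higher orders follow
  by the recursion. Each step also needs the value at \<open>z = 0\<close>, which is a limit uniform
  in \<open>t\<close>.\<close>

lemma continuous_on_moment_if_eta_tr:
  fixes \<mu> :: "real \<Rightarrow> complex measure"
  assumes \<mu>: "\<And>t. 0 \<le> t \<Longrightarrow> prob_T (\<mu> t)"
    and \<eta>: "\<And>z. norm z < 1 \<Longrightarrow> continuous_on {0..} (\<lambda>t. eta_tr (\<mu> t) z)"
  shows "continuous_on {0..} (\<lambda>t. \<integral>\<zeta>. \<zeta> ^ k \<partial>(\<mu> t))"
proof -
  have zero: "continuous_on {0..} (\<lambda>t. cauchy_moment (\<mu> t) k 0)"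
    if c: "\<And>z. z \<noteq> 0 \<Longrightarrow> norm z < 1 \<Longrightarrow> continuous_on {0..} (\<lambda>t. cauchy_moment (\<mu> t) k z)" for k
  proof (rule uniform_limit_theorem)
    have near: "\<forall>\<^sub>F z in at (0::complex). z \<noteq> 0 \<and> norm z < d" if "d > 0" for d
      unfolding eventually_at by (rule exI[of _ d]) (use that in auto)
    show "\<forall>\<^sub>F z in at 0. continuous_on {0..} (\<lambda>t. cauchy_moment (\<mu> t) k z)"
      using near[of 1] by (auto elim!: eventually_mono intro: c)
    \<comment> \<open>The recursion bounds the difference by \<open>norm z / (1 - norm z)\<close>,
      hence by \<open>2 * norm z\<close> when \<open>norm z < 1/2\<close>, for all \<open>t\<close>
      at once.\<close>
    show "uniform_limit {0..} (\<lambda>z t. cauchy_moment (\<mu> t) k z) (\<lambda>t. cauchy_moment (\<mu> t) k 0) (at 0)"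
    proof (rule uniform_limitI)
      fix e :: real assume "e > 0"
      then have "\<forall>\<^sub>F z in at (0::complex). z \<noteq> 0 \<and> norm z < min (1/2) (e/2)" by (intro near) auto
      then show "\<forall>\<^sub>F z in at 0. \<forall>t\<in>{0..}. dist (cauchy_moment (\<mu> t) k z) (cauchy_moment (\<mu> t) k 0) < e"
      proof eventually_elim
        case (elim z)
        show ?case
        proof
          fix t :: real assume t: "t \<in> {0..}"
          have "dist (cauchy_moment (\<mu> t) k z) (cauchy_moment (\<mu> t) k 0) = norm z * norm (cauchy_moment (\<mu> t) (Suc k) z)"
            using cauchy_moment_Suc[of "\<mu> t" z k] \<mu> t elim by (simp add: dist_norm norm_mult)
          also have "\<dots> \<le> norm z * (1 / (1 - norm z))"
            using norm_cauchy_moment_le[of "\<mu> t" z] \<mu> t elim by (intro mult_left_mono) auto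
          also have "\<dots> \<le> norm z * 2"
            using elim by (intro mult_left_mono) (auto simp: field_simps)
          also have "\<dots> < e" using elim by simp
          finally show "dist (cauchy_moment (\<mu> t) k z) (cauchy_moment (\<mu> t) k 0) < e" .
        qed
      qed
    qed
  qed simp
  have "continuous_on {0..} (\<lambda>t. cauchy_moment (\<mu> t) k z)" if "z \<noteq> 0" "norm z < 1" for z
    using that
  proof (induction k arbitrary: z)
    case 0
    have lt: "eta_tr (\<mu> t) z \<noteq> 1" if "0 \<le> t" for t
      using norm_eta_tr_le(1)[OF \<mu>[OF that] 0(2)] 0(2) by auto
    have "continuous_on {0..} (\<lambda>t. 1 / (1 - eta_tr (\<mu> t) z))"
      using lt by (intro continuous_intros \<eta> 0) auto
    moreover have "1 / (1 - eta_tr (\<mu> t) z) = cauchy_moment (\<mu> t) 0 z" if "0 \<le> t" for t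
    proof -
      have "eta_tr (\<mu> t) z = (cauchy_moment (\<mu> t) 0 z - 1) / cauchy_moment (\<mu> t) 0 z"
        unfolding eta_tr_def using one_plus_psi_tr(1)[OF \<mu>[OF that] 0(2)] by (metis add_diff_cancel_left')
      then show ?thesis
        using cauchy_moment_nonzero[OF \<mu>[OF that] 0(2)] by (simp add: diff_divide_distrib)
    qed
    ultimately show ?case by (rule continuous_on_eq) auto
  next
    case (Suc k)
    have "continuous_on {0..} (\<lambda>t. (cauchy_moment (\<mu> t) k z - cauchy_moment (\<mu> t) k 0) / z)"
      using Suc by (intro continuous_intros zero Suc.IH) auto
    then show ?case
      by (rule continuous_on_eq) (use Suc.prems \<mu> in \<open>auto simp: cauchy_moment_Suc\<close>)
  qed
  from zero[OF this] show ?thesis by (simp add: cauchy_moment_def)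
qed

text \<open>On the circle \<open>cnj \<zeta>\<close> is the inverse of \<open>\<zeta>\<close>, so a
  mixed monomial is a power of \<open>\<zeta>\<close> or the conjugate of one.\<close>

lemma continuous_on_moment2_if_eta_tr:
  fixes \<mu> :: "real \<Rightarrow> complex measure"
  assumes \<mu>: "\<And>t. 0 \<le> t \<Longrightarrow> prob_T (\<mu> t)"
    and \<eta>: "\<And>z. norm z < 1 \<Longrightarrow> continuous_on {0..} (\<lambda>t. eta_tr (\<mu> t) z)"
  shows "continuous_on {0..} (\<lambda>t. \<integral>\<zeta>. \<zeta> ^ j * cnj \<zeta> ^ k \<partial>(\<mu> t))"
proof -
  have sp: "norm \<zeta> = 1" if "\<zeta> \<in> space (\<mu> t)" "0 \<le> t" for \<zeta> t
    using space_finite_meas_T[OF finite_meas_T_if_prob_T[OF \<mu>[OF that(2)]]] that by auto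
  have c1: "\<zeta> * cnj \<zeta> = 1" if "norm \<zeta> = 1" for \<zeta>
    using complex_norm_square[of \<zeta>] that by simp
  show ?thesis
  proof (cases "k \<le> j")
    case True
    have "\<zeta> ^ j * cnj \<zeta> ^ k = \<zeta> ^ (j - k)" if "norm \<zeta> = 1" for \<zeta>
    proof -
      have "\<zeta> ^ j = \<zeta> ^ (j - k) * \<zeta> ^ k" using True by (simp flip: power_add)
      then have "\<zeta> ^ j * cnj \<zeta> ^ k = \<zeta> ^ (j - k) * (\<zeta> * cnj \<zeta>) ^ k"
        by (simp add: power_mult_distrib)
      then show ?thesis by (simp add: c1[OF that])
    qed
    then have "(\<integral>\<zeta>. \<zeta> ^ (j - k) \<partial>(\<mu> t)) = (\<integral>\<zeta>. \<zeta> ^ j * cnj \<zeta> ^ k \<partial>(\<mu> t))" if "0 \<le> t" for t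
      using sp[OF _ that] by (intro Bochner_Integration.integral_cong) auto
    then show ?thesis
      using continuous_on_eq[OF continuous_on_moment_if_eta_tr[OF assms, of "j - k"]] by auto
  next
    case False
    have "\<zeta> ^ j * cnj \<zeta> ^ k = cnj (\<zeta> ^ (k - j))" if "norm \<zeta> = 1" for \<zeta>
    proof -
      have "cnj \<zeta> ^ k = cnj \<zeta> ^ (k - j) * cnj \<zeta> ^ j" using False by (simp flip: power_add)
      then have "\<zeta> ^ j * cnj \<zeta> ^ k = cnj \<zeta> ^ (k - j) * (\<zeta> * cnj \<zeta>) ^ j"
        by (simp add: power_mult_distrib)
      then show ?thesis by (simp add: c1[OF that])
    qed
    then have "(\<integral>\<zeta>. cnj (\<zeta> ^ (k - j)) \<partial>(\<mu> t)) = (\<integral>\<zeta>. \<zeta> ^ j * cnj \<zeta> ^ k \<partial>(\<mu> t))" if "0 \<le> t" for t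
      using sp[OF _ that] by (intro Bochner_Integration.integral_cong) auto
    then have "cnj (\<integral>\<zeta>. \<zeta> ^ (k - j) \<partial>(\<mu> t)) = (\<integral>\<zeta>. \<zeta> ^ j * cnj \<zeta> ^ k \<partial>(\<mu> t))" if "0 \<le> t" for t
      using that by (simp only: Bochner_Integration.integral_cnj)
    then show ?thesis
      using continuous_on_eq[OF continuous_on_cnj[OF continuous_on_moment_if_eta_tr[OF assms, of "k - j"]]] by auto
  qed
qed

text \<open>The functions all of whose products with trigonometric monomials have continuous integrals
  are stable under multiplication by real polynomials, so induction over polynomials applies.\<close>
lemma weakly_continuous_if_eta_tr:
  fixes \<mu> :: "real \<Rightarrow> complex measure"
  assumes \<mu>: "\<And>t. 0 \<le> t \<Longrightarrow> prob_T (\<mu> t)"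
    and \<eta>: "\<And>z. norm z < 1 \<Longrightarrow> continuous_on {0..} (\<lambda>t. eta_tr (\<mu> t) z)"
  shows "weakly_continuous \<mu>"
proof -
  note i = integrable_finite_meas_T[OF finite_meas_T_if_prob_T[OF \<mu>]]
  define G :: "(complex \<Rightarrow> complex) set" where
    "G = {g. continuous_on (sphere 0 1) g \<and>
       (\<forall>j k. continuous_on {0..} (\<lambda>t. \<integral>\<zeta>. g \<zeta> * (\<zeta> ^ j * cnj \<zeta> ^ k) \<partial>(\<mu> t)))}"
  have lin: "(\<lambda>\<zeta>. a * g \<zeta> + b * h \<zeta>) \<in> G" if g: "g \<in> G" and h: "h \<in> G" for a b g h
  proof -
    have gc: "continuous_on (sphere 0 1) g" and hc: "continuous_on (sphere 0 1) h"
      using g h by (auto simp: G_def)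
    have "continuous_on {0..} (\<lambda>t. \<integral>\<zeta>. (a * g \<zeta> + b * h \<zeta>) * (\<zeta> ^ j * cnj \<zeta> ^ k) \<partial>(\<mu> t))" for j k
    proof -
      have "continuous_on {0..} (\<lambda>t. a * (\<integral>\<zeta>. g \<zeta> * (\<zeta> ^ j * cnj \<zeta> ^ k) \<partial>(\<mu> t))
          + b * (\<integral>\<zeta>. h \<zeta> * (\<zeta> ^ j * cnj \<zeta> ^ k) \<partial>(\<mu> t)))"
        using g h by (intro continuous_intros) (auto simp: G_def)
      then show ?thesis
      proof (rule continuous_on_eq)
        fix t :: real assume "t \<in> {0..}"
        then have t: "0 \<le> t" by simp
        have "integrable (\<mu> t) (\<lambda>\<zeta>. g \<zeta> * (\<zeta> ^ j * cnj \<zeta> ^ k))" "integrable (\<mu> t) (\<lambda>\<zeta>. h \<zeta> * (\<zeta> ^ j * cnj \<zeta> ^ k))"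
          using t by (auto intro!: i continuous_intros gc hc)
        then have "(\<integral>\<zeta>. a * (g \<zeta> * (\<zeta> ^ j * cnj \<zeta> ^ k)) + b * (h \<zeta> * (\<zeta> ^ j * cnj \<zeta> ^ k)) \<partial>(\<mu> t))
          = a * (\<integral>\<zeta>. g \<zeta> * (\<zeta> ^ j * cnj \<zeta> ^ k) \<partial>(\<mu> t)) + b * (\<integral>\<zeta>. h \<zeta> * (\<zeta> ^ j * cnj \<zeta> ^ k) \<partial>(\<mu> t))"
          by (subst Bochner_Integration.integral_add) auto
        then show "a * (\<integral>\<zeta>. g \<zeta> * (\<zeta> ^ j * cnj \<zeta> ^ k) \<partial>(\<mu> t)) + b * (\<integral>\<zeta>. h \<zeta> * (\<zeta> ^ j * cnj \<zeta> ^ k) \<partial>(\<mu> t))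
          = (\<integral>\<zeta>. (a * g \<zeta> + b * h \<zeta>) * (\<zeta> ^ j * cnj \<zeta> ^ k) \<partial>(\<mu> t))"
          by (simp add: distrib_right mult.assoc)
      qed
    qed
    then show ?thesis using gc hc by (auto simp: G_def intro!: continuous_intros)
  qed
  have mz: "(\<lambda>\<zeta>. \<zeta> * g \<zeta>) \<in> G" if "g \<in> G" for g
  proof -
    have "continuous_on {0..} (\<lambda>t. \<integral>\<zeta>. \<zeta> * g \<zeta> * (\<zeta> ^ j * cnj \<zeta> ^ k) \<partial>(\<mu> t))" for j k
    proof -
      have "continuous_on {0..} (\<lambda>t. \<integral>\<zeta>. g \<zeta> * (\<zeta> ^ Suc j * cnj \<zeta> ^ k) \<partial>(\<mu> t))"
        using that unfolding G_def by blast
      then show ?thesis by (simp add: mult_ac)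
    qed
    then show ?thesis using that by (auto simp: G_def intro!: continuous_intros)
  qed
  have mc: "(\<lambda>\<zeta>. cnj \<zeta> * g \<zeta>) \<in> G" if "g \<in> G" for g
  proof -
    have "continuous_on {0..} (\<lambda>t. \<integral>\<zeta>. cnj \<zeta> * g \<zeta> * (\<zeta> ^ j * cnj \<zeta> ^ k) \<partial>(\<mu> t))" for j k
    proof -
      have "continuous_on {0..} (\<lambda>t. \<integral>\<zeta>. g \<zeta> * (\<zeta> ^ j * cnj \<zeta> ^ Suc k) \<partial>(\<mu> t))"
        using that unfolding G_def by blast
      then show ?thesis by (simp add: mult_ac)
    qed
    then show ?thesis using that by (auto simp: G_def intro!: continuous_intros)
  qed
  have one: "(\<lambda>_. 1) \<in> G"
    using continuous_on_moment2_if_eta_tr[OF assms] by (auto simp: G_def)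
  \<comment> \<open>With \<open>g\<close> arbitrary in the induction, the product case is two
    successive multiplications.\<close>
  have poly: "(\<lambda>\<zeta>. of_real (p \<zeta>) * g \<zeta>) \<in> G" if "real_polynomial_function p" "g \<in> G" for p g
    using that
  proof (induction p arbitrary: g rule: real_polynomial_function.induct)
    case (linear p)
    interpret bounded_linear p by (rule linear.hyps)
    \<comment> \<open>Coefficients that write the real-linear functional \<open>p\<close> through
      \<open>\<zeta>\<close> and \<open>cnj \<zeta>\<close>; they are conjugate to each other
      because \<open>p\<close> is real.\<close>
    define \<alpha> where "\<alpha> = Complex (p 1) (- p \<i>) / 2"
    define \<beta> where "\<beta> = Complex (p 1) (p \<i>) / 2"
    have "complex_of_real (p \<zeta>) = \<alpha> * \<zeta> + \<beta> * cnj \<zeta>" for \<zeta>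
    proof -
      have "\<zeta> = Re \<zeta> *\<^sub>R 1 + Im \<zeta> *\<^sub>R \<i>" by (simp add: complex_eq_iff)
      then have "p \<zeta> = Re \<zeta> * p 1 + Im \<zeta> * p \<i>" by (metis add scaleR real_scaleR_def)
      then show ?thesis by (simp add: \<alpha>_def \<beta>_def complex_eq_iff field_simps)
    qed
    then have "(\<lambda>\<zeta>. of_real (p \<zeta>) * g \<zeta>) = (\<lambda>\<zeta>. \<alpha> * (\<zeta> * g \<zeta>) + \<beta> * (cnj \<zeta> * g \<zeta>))"
      by (simp add: fun_eq_iff algebra_simps)
    then show ?case using lin[OF mz[OF linear.prems] mc[OF linear.prems]] by simp
  next
    case (const c)
    then show ?case using lin[of g g "of_real c" 0] by simp
  next
    case (add p q)
    then show ?case using lin[OF add.IH(1)[OF add.prems] add.IH(2)[OF add.prems], of 1 1] by (simp add: algebra_simps)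
  next
    case (mult p q)
    then show ?case using mult.IH(1)[OF mult.IH(2)[OF mult.prems]] by (simp add: mult.assoc)
  qed
  have pc: "continuous_on {0..} (\<lambda>t. \<integral>\<zeta>. p \<zeta> \<partial>(\<mu> t))" if "real_polynomial_function p" for p
  proof -
    have "continuous_on {0..} (\<lambda>t. \<integral>\<zeta>. of_real (p \<zeta>) * 1 * (\<zeta> ^ 0 * cnj \<zeta> ^ 0) \<partial>(\<mu> t))"
      using poly[OF that one] unfolding G_def by blast
    then have "continuous_on {0..} (\<lambda>t. complex_of_real (\<integral>\<zeta>. p \<zeta> \<partial>(\<mu> t)))" by simp
    from continuous_on_Re[OF this] show ?thesis by simp
  qed
  show ?thesis
    unfolding weakly_continuous_def
  proof (intro allI impI)
    fix f :: "complex \<Rightarrow> real" assume f: "continuous_on (sphere 0 1) f"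
    have "\<exists>p. real_polynomial_function p \<and> (\<forall>x\<in>sphere 0 1. \<bar>f x - p x\<bar> < 1 / real (Suc n))" for n
      by (rule Stone_Weierstrass_real_polynomial_function[OF compact_sphere f, of "1 / real (Suc n)"]) auto
    then obtain P where P: "\<And>n. real_polynomial_function (P n)"
      and fP: "\<And>n x. x \<in> sphere 0 1 \<Longrightarrow> \<bar>f x - P n x\<bar> < 1 / real (Suc n)" by metis
    have Pc: "continuous_on (sphere 0 1) (P n)" for n
      using P continuous_on_polymonial_function real_polynomial_function_eq by blast
    show "continuous_on {0..} (\<lambda>t. \<integral>\<zeta>. f \<zeta> \<partial>(\<mu> t))"
    proof (rule uniform_limit_theorem)
      show "\<forall>\<^sub>F n in sequentially. continuous_on {0..} (\<lambda>t. \<integral>\<zeta>. P n \<zeta> \<partial>(\<mu> t))"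
        using pc[OF P] by simp
      show "uniform_limit {0..} (\<lambda>n t. \<integral>\<zeta>. P n \<zeta> \<partial>(\<mu> t)) (\<lambda>t. \<integral>\<zeta>. f \<zeta> \<partial>(\<mu> t)) sequentially"
      proof (rule uniform_limitI)
        fix e :: real assume "e > 0"
        then have "\<forall>\<^sub>F n in sequentially. 1 / real (Suc n) < e" by real_asymp
        then show "\<forall>\<^sub>F n in sequentially. \<forall>t\<in>{0..}. dist (\<integral>\<zeta>. P n \<zeta> \<partial>(\<mu> t)) (\<integral>\<zeta>. f \<zeta> \<partial>(\<mu> t)) < e"
        proof eventually_elim
          case (elim n)
          show ?case
          proof
            fix t :: real assume "t \<in> {0..}"
            then have t: "0 \<le> t" by simp
            have "dist (\<integral>\<zeta>. P n \<zeta> \<partial>(\<mu> t)) (\<integral>\<zeta>. f \<zeta> \<partial>(\<mu> t)) = norm (\<integral>\<zeta>. P n \<zeta> - f \<zeta> \<partial>(\<mu> t))"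
              using t by (simp add: dist_norm i Pc f)
            also have "\<dots> \<le> 1 / real (Suc n)"
              by (rule norm_integral_prob_T_le[OF \<mu>[OF t]])
                 (use fP[of _ n] in \<open>auto intro!: continuous_intros Pc f less_imp_le simp: abs_minus_commute\<close>)
            finally show "dist (\<integral>\<zeta>. P n \<zeta> \<partial>(\<mu> t)) (\<integral>\<zeta>. f \<zeta> \<partial>(\<mu> t)) < e" using elim by simp
          qed
        qed
      qed
    qed simp
  qed
qed

section \<open>Flows of holomorphic vector fields on the disc\<close>

text \<open>The derivative has modulus \<open>exp (Re z)\<close>, at most 1 on the left half-plane,
  which is convex.\<close>

lemma norm_exp_diff_le:
  fixes x y :: complex
  assumes "Re x \<le> 0" "Re y \<le> 0"
  shows "norm (exp x - exp y) \<le> norm (x - y)"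
proof -
  have "convex {z. Re z \<le> 0}" by (rule convex_halfspace_Re_le)
  then have "norm (exp x - exp y) \<le> 1 * norm (x - y)"
    by (rule field_differentiable_bound[where f' = exp])
       (use assms in \<open>auto intro!: derivative_eq_intros simp: norm_exp_eq_Re\<close>)
  then show ?thesis by simp
qed

lemma has_vector_derivative_exp_integral:
  fixes q :: "real \<Rightarrow> complex"
  assumes q: "continuous_on {0..} q" and t: "0 \<le> t"
  shows "((\<lambda>t. z * exp (integral {0..t} q)) has_vector_derivative z * exp (integral {0..t} q) * q t) (at t within {0..})"
proof -
  have "((exp \<circ> (\<lambda>t. integral {0..t} q)) has_vector_derivative q t * exp (integral {0..t} q)) (at t within {0..})"
    by (rule field_vector_diff_chain_within[OF integral_has_vector_derivative_atLeast[OF q t]])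
       (auto intro: has_field_derivative_at_within)
  from has_vector_derivative_mult_right[OF this, of z] show ?thesis
    by (simp add: o_def mult_ac)
qed

lemma Re_integral_nonpos:
  fixes q :: "real \<Rightarrow> complex"
  assumes "continuous_on {0..t} q" "\<And>s. s \<in> {0..t} \<Longrightarrow> Re (q s) \<le> 0"
  shows "Re (integral {0..t} q) \<le> 0"
proof -
  have i: "q integrable_on {0..t}" using assms(1) by (rule integrable_continuous_real)
  have "((\<lambda>s. Re (q s)) has_integral Re (integral {0..t} q)) {0..t}"
    by (rule has_integral_Re[OF integrable_integral[OF i]])
  then show ?thesis by (rule has_integral_le[OF _ has_integral_0]) (use assms(2) in auto)
qed

lemma norm_mult_exp_integral_le:
  fixes q :: "real \<Rightarrow> complex"
  assumes "continuous_on {0..t} q" "\<And>s. s \<in> {0..t} \<Longrightarrow> Re (q s) \<le> 0"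
  shows "norm (z * exp (integral {0..t} q)) \<le> norm z"
  using Re_integral_nonpos[OF assms] by (simp add: norm_mult norm_exp_eq_Re mult_left_le)

text \<open>Rescaling time by \<open>t\<close> moves the variable endpoint into the integrand, over
  the fixed unit interval, where continuity of parameter integrals applies.\<close>

lemma continuous_on_integral_upto:
  fixes v :: "real \<Rightarrow> complex \<Rightarrow> complex"
  assumes v: "continuous_on ({0..} \<times> U) (\<lambda>(t, z). v t z)"
  shows "continuous_on ({0..} \<times> U) (\<lambda>(t, z). integral {0..t} (\<lambda>s. v s z))"
proof -
  have "continuous_on (({0..} \<times> U) \<times> cbox 0 1) (\<lambda>p. case (fst (fst p) * snd p, snd (fst p)) of (t, z) \<Rightarrow> v t z)"
    by (rule continuous_on_compose2[OF v]) (auto intro!: continuous_intros)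
  then have "continuous_on (({0..} \<times> U) \<times> cbox 0 1) (\<lambda>(x, s). v (fst x * s) (snd x))"
    by (simp add: case_prod_beta)
  then have "continuous_on ({0..} \<times> U) (\<lambda>x. integral (cbox 0 1) (\<lambda>s. v (fst x * s) (snd x)))"
    by (rule integral_continuous_on_param)
  then have "continuous_on ({0..} \<times> U) (\<lambda>x. fst x *\<^sub>R integral {0..1} (\<lambda>s. v (fst x * s) (snd x)))"
    by (auto intro!: continuous_intros)
  then show ?thesis
  proof (rule continuous_on_eq, clarsimp)
    fix t :: real and z assume t: "0 \<le> t" and z: "z \<in> U"
    show "t *\<^sub>R integral {0..1} (\<lambda>s. v (t * s) z) = integral {0..t} (\<lambda>s. v s z)"
    proof (cases "t = 0")
      case False
      have "(\<lambda>s. v s z) integrable_on {0..t}"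
        by (rule integrable_continuous_real) (rule continuous_on_section_left[OF v z], auto)
      then have "((\<lambda>s. v s z) has_integral integral {0..t} (\<lambda>s. v s z)) {0..t}" by (rule integrable_integral)
      from has_integral_stretch_real[OF this False]
      have "((\<lambda>s. v (t * s) z) has_integral (1 / t) *\<^sub>R integral {0..t} (\<lambda>s. v s z)) {0..1}"
        using t False by simp
      then show ?thesis using False by (simp add: integral_unique)
    qed simp
  qed
qed

lemma holomorphic_lipschitz_on_cball:
  fixes B :: "complex \<Rightarrow> complex"
  assumes B: "B holomorphic_on ball 0 1" and r: "r < 1"
  obtains L where "0 \<le> L" "\<And>x y. norm x \<le> r \<Longrightarrow> norm y \<le> r \<Longrightarrow> norm (B x - B y) \<le> L * norm (x - y)"
proof -
  have sub: "cball 0 r \<subseteq> ball (0::complex) 1" using r by auto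
  have "deriv B holomorphic_on ball 0 1" by (rule holomorphic_deriv[OF B open_ball])
  then have "continuous_on (cball 0 r) (deriv B)"
    using sub holomorphic_on_imp_continuous_on continuous_on_subset by blast
  then have "bounded (deriv B ` cball 0 r)"
    by (intro compact_imp_bounded compact_continuous_image) auto
  then obtain L where L: "\<And>x. x \<in> cball 0 r \<Longrightarrow> norm (deriv B x) \<le> L"
    unfolding bounded_iff by (meson imageI)
  show ?thesis
  proof (rule that[of "max L 0"])
    fix x y :: complex assume xy: "norm x \<le> r" "norm y \<le> r"
    show "norm (B x - B y) \<le> max L 0 * norm (x - y)"
    proof (rule field_differentiable_bound[of "cball 0 r"])
      show "(B has_field_derivative deriv B z) (at z within cball 0 r)" if "z \<in> cball 0 r" for z
        using holomorphic_derivI[OF B open_ball, of z] sub that has_field_derivative_at_within by blast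
      show "norm (deriv B z) \<le> max L 0" if "z \<in> cball 0 r" for z using L[OF that] by simp
    qed (use xy in auto)
  qed auto
qed

section \<open>Global flow of the field \<open>z * B z\<close> by Picard iteration\<close>

locale disc_field =
  fixes B :: "complex \<Rightarrow> complex"
  assumes holoB: "B holomorphic_on ball 0 1" and ReB: "norm z < 1 \<Longrightarrow> Re (B z) \<le> 0"
begin

definition step :: "(real \<Rightarrow> complex \<Rightarrow> complex) \<Rightarrow> real \<Rightarrow> complex \<Rightarrow> complex" where
  "step u t z = z * exp (integral {0..t} (\<lambda>s. B (u s z)))"

text \<open>Since \<open>Re B \<le> 0\<close> on the disc, the exponential form of the Picard iteration never
  leaves the disc of radius \<^term>\<open>norm z\<close>, so it converges for all times.\<close>
primrec picard :: "nat \<Rightarrow> real \<Rightarrow> complex \<Rightarrow> complex" where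
  "picard 0 = (\<lambda>t z. z)"
| "picard (Suc n) = step (picard n)"

text \<open>The invariant of the iteration, which passes to its limit. The bound by
  \<open>norm z\<close> keeps the iterates where \<open>Re B\<close> is nonpositive, and hence the
  next iterate obeys it again.\<close>

definition schwarz_family :: "(real \<Rightarrow> complex \<Rightarrow> complex) \<Rightarrow> bool" where
  "schwarz_family u \<longleftrightarrow> continuous_on ({0..} \<times> ball 0 1) (\<lambda>(t, z). u t z) \<and>
     (\<forall>t\<ge>0. u t holomorphic_on ball 0 1) \<and> (\<forall>t\<ge>0. \<forall>z\<in>ball 0 1. norm (u t z) \<le> norm z)"

lemma schwarz_family_maps: "schwarz_family u \<Longrightarrow> 0 \<le> t \<Longrightarrow> norm z < 1 \<Longrightarrow> norm (u t z) < 1"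
  unfolding schwarz_family_def by (meson le_less_trans mem_ball_0)

text \<open>Stated for a general \<open>A\<close>, because the first component later integrates
  \<open>B1\<close> along the flow of \<open>B2\<close>.\<close>

lemma holomorphic_comp_family:
  assumes A: "A holomorphic_on ball 0 1" and u: "schwarz_family u" and t: "0 \<le> t"
  shows "(\<lambda>z. A (u t z)) holomorphic_on ball 0 1"
  by (rule holomorphic_on_compose_gen[OF _ A, unfolded o_def])
     (use u t schwarz_family_maps[OF u t] in \<open>auto simp: schwarz_family_def\<close>)

lemma continuous_comp_family:
  assumes A: "A holomorphic_on ball 0 1" and u: "schwarz_family u"
  shows "continuous_on ({0..} \<times> ball 0 1) (\<lambda>(t, z). A (u t z))"
proof -
  have "continuous_on ({0..} \<times> ball 0 1) (\<lambda>x. A (case x of (t, z) \<Rightarrow> u t z))"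
    by (rule continuous_on_compose2[OF holomorphic_on_imp_continuous_on[OF A]])
       (use u schwarz_family_maps[OF u] in \<open>auto simp: schwarz_family_def\<close>)
  then show ?thesis by (simp add: case_prod_beta)
qed

lemma holomorphic_exp_integral_family:
  assumes A: "A holomorphic_on ball 0 1" and u: "schwarz_family u"
  shows "(\<lambda>z. z * exp (integral {0..t} (\<lambda>s. A (u s z)))) holomorphic_on ball 0 1"
proof -
  have "(\<lambda>z. integral {0..t} (\<lambda>s. A (u s z))) holomorphic_on ball 0 1"
    by (rule holomorphic_integral_param)
       (use holomorphic_comp_family[OF A u] in \<open>auto intro: continuous_on_subset[OF continuous_comp_family[OF A u]]\<close>)
  then show ?thesis by (intro holomorphic_intros)
qed

lemma cont_time_family:
  assumes A: "A holomorphic_on ball 0 1" and u: "schwarz_family u" and z: "norm z < 1"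
  shows "continuous_on {0..} (\<lambda>t. A (u t z))"
  by (rule continuous_on_section_left[OF continuous_comp_family[OF A u]]) (use z in auto)

lemma schwarz_family_step:
  assumes u: "schwarz_family u"
  shows "schwarz_family (step u)"
  unfolding schwarz_family_def
proof (intro conjI allI impI ballI)
  have c: "continuous_on ({0..} \<times> ball 0 1) (\<lambda>x. integral {0..fst x} (\<lambda>s. B (u s (snd x))))"
    using continuous_on_integral_upto[OF continuous_comp_family[OF holoB u]] by (simp add: case_prod_beta)
  show "continuous_on ({0..} \<times> ball 0 1) (\<lambda>(t, z). step u t z)"
    unfolding step_def case_prod_beta by (intro continuous_intros c)
  show "step u t holomorphic_on ball 0 1" for t
    using holomorphic_exp_integral_family[OF holoB u] by (simp add: step_def[abs_def])
  fix t :: real and z :: complex assume t: "0 \<le> t" and z: "z \<in> ball 0 1"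
  show "norm (step u t z) \<le> norm z"
    unfolding step_def
    by (rule norm_mult_exp_integral_le)
       (use z schwarz_family_maps[OF u] ReB in \<open>auto intro: continuous_on_subset[OF cont_time_family[OF holoB u]]\<close>)
qed

lemma schwarz_family_picard: "schwarz_family (picard n)"
  by (induction n)
     (auto simp: schwarz_family_step, auto simp: schwarz_family_def case_prod_beta intro!: continuous_intros holomorphic_intros)

text \<open>Since \<open>exp\<close> is 1-Lipschitz on the left half-plane and \<open>B\<close> is
  \<open>L\<close>-Lipschitz on the disc of radius \<open>r\<close>, one step multiplies the bound
  by \<open>L\<close> and integrates it, which gives the next term of an exponential series.
  Convergence for all times rests on this factorial gain.\<close>

lemma exp_integral_contraction:
  assumes a: "continuous_on {0..} a" "\<And>s. 0 \<le> s \<Longrightarrow> norm (a s) \<le> r"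
    and b: "continuous_on {0..} b" "\<And>s. 0 \<le> s \<Longrightarrow> norm (b s) \<le> r"
    and r: "r < 1" and L0: "0 \<le> L"
    and L: "\<And>x y. norm x \<le> r \<Longrightarrow> norm y \<le> r \<Longrightarrow> norm (B x - B y) \<le> L * norm (x - y)"
    and le: "\<And>s. s \<in> {0..t} \<Longrightarrow> norm (a s - b s) \<le> K * (L * s) ^ n / fact n"
    and t: "0 \<le> t" and z: "norm z \<le> 1"
  shows "norm (z * exp (integral {0..t} (\<lambda>s. B (a s))) - z * exp (integral {0..t} (\<lambda>s. B (b s))))
     \<le> K * (L * t) ^ Suc n / fact (Suc n)"
proof -
  have cB: "continuous_on (cball 0 r) B"
    using holomorphic_on_imp_continuous_on[OF holoB] r by (auto elim!: continuous_on_subset)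
  have ca: "continuous_on {0..t} (\<lambda>s. B (a s))" and cb: "continuous_on {0..t} (\<lambda>s. B (b s))"
    using a b by (auto intro!: continuous_on_compose2[OF cB] intro: continuous_on_subset)
  have Ra: "Re (integral {0..t} (\<lambda>s. B (a s))) \<le> 0" and Rb: "Re (integral {0..t} (\<lambda>s. B (b s))) \<le> 0"
    using le_less_trans[OF a(2) r] le_less_trans[OF b(2) r] by (auto intro!: Re_integral_nonpos ca cb ReB)
  have I: "((\<lambda>s. L * (K * (L * s) ^ n / fact n)) has_integral
      K * (L * t) ^ Suc n / fact (Suc n) - K * (L * 0) ^ Suc n / fact (Suc n)) {0..t}"
  proof (rule fundamental_theorem_of_calculus[OF t])
    fix s assume "s \<in> {0..t}"
    have "((\<lambda>s. K * (L * s) ^ Suc n / fact (Suc n)) has_real_derivative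
        K * (real (Suc n) * (L * s) ^ n * L) / fact (Suc n)) (at s within {0..t})"
      by (auto intro!: derivative_eq_intros simp del: fact_Suc power_Suc)
    also have "K * (real (Suc n) * (L * s) ^ n * L) / fact (Suc n) = L * (K * (L * s) ^ n / fact n)"
    proof -
      have "K * (m * P * L) / (m * F) = L * (K * P / F)" if "m \<noteq> 0" for m P F :: real
        using that by simp
      from this[of "real (Suc n)"] show ?thesis unfolding fact_Suc by simp
    qed
    finally show "((\<lambda>s. K * (L * s) ^ Suc n / fact (Suc n)) has_vector_derivative L * (K * (L * s) ^ n / fact n)) (at s within {0..t})"
      by (simp add: has_real_derivative_iff_has_vector_derivative)
  qed
  have "norm (z * exp (integral {0..t} (\<lambda>s. B (a s))) - z * exp (integral {0..t} (\<lambda>s. B (b s))))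
      = norm z * norm (exp (integral {0..t} (\<lambda>s. B (a s))) - exp (integral {0..t} (\<lambda>s. B (b s))))"
    by (simp flip: right_diff_distrib norm_mult)
  also have "\<dots> \<le> 1 * norm (integral {0..t} (\<lambda>s. B (a s)) - integral {0..t} (\<lambda>s. B (b s)))"
    by (intro mult_mono z norm_exp_diff_le Ra Rb) auto
  also have "\<dots> = norm (integral {0..t} (\<lambda>s. B (a s) - B (b s)))"
    using ca cb by (simp add: integral_diff integrable_continuous_real)
  also have "\<dots> \<le> integral {0..t} (\<lambda>s. L * (K * (L * s) ^ n / fact n))"
  proof (rule integral_norm_bound_integral)
    show "(\<lambda>s. B (a s) - B (b s)) integrable_on {0..t}"
      by (intro integrable_continuous_real continuous_intros ca cb)
    show "(\<lambda>s. L * (K * (L * s) ^ n / fact n)) integrable_on {0..t}"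
      by (intro integrable_continuous_real continuous_intros) auto
    fix s assume s: "s \<in> {0..t}"
    have "norm (B (a s) - B (b s)) \<le> L * norm (a s - b s)" using s a b by (intro L) auto
    also have "\<dots> \<le> L * (K * (L * s) ^ n / fact n)" using le[OF s] L0 by (rule mult_left_mono)
    finally show "norm (B (a s) - B (b s)) \<le> L * (K * (L * s) ^ n / fact n)" .
  qed
  also have "\<dots> = K * (L * t) ^ Suc n / fact (Suc n)"
    using integral_unique[OF I] by (simp only: mult_zero_right power_0_Suc div_0 diff_0_right)
  finally show ?thesis .
qed

lemma cont_time_picard: "norm z < 1 \<Longrightarrow> continuous_on {0..} (\<lambda>t. picard n t z)"
  using cont_time_family[OF holomorphic_on_ident schwarz_family_picard] .

lemma norm_picard_le: "norm z < 1 \<Longrightarrow> 0 \<le> t \<Longrightarrow> norm (picard n t z) \<le> norm z"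
  using schwarz_family_picard[of n] by (simp add: schwarz_family_def)

text \<open>The contraction estimate is iterated between a fixed point and the iterates; the
  constant 2 comes from the start, where both norms are below 1.\<close>

lemma picard_diff_le:
  assumes u: "continuous_on {0..} u" "\<And>s. 0 \<le> s \<Longrightarrow> norm (u s) \<le> norm z"
    and fix_eq: "(\<forall>t\<ge>0. u t = z * exp (integral {0..t} (\<lambda>s. B (u s))))"
    and z: "norm z \<le> r" and r: "r < 1" and L0: "0 \<le> L"
    and L: "\<And>x y. norm x \<le> r \<Longrightarrow> norm y \<le> r \<Longrightarrow> norm (B x - B y) \<le> L * norm (x - y)"
    and t: "0 \<le> t"
  shows "norm (u t - picard n t z) \<le> 2 * (L * t) ^ n / fact n"
  using t
proof (induction n arbitrary: t)
  case 0
  have "norm (u t - z) \<le> norm (u t) + norm z" by (rule norm_triangle_ineq4)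
  then show ?case using u(2)[OF 0] z r by simp
next
  case (Suc n)
  have "norm (z * exp (integral {0..t} (\<lambda>s. B (u s))) - z * exp (integral {0..t} (\<lambda>s. B (picard n s z))))
      \<le> 2 * (L * t) ^ Suc n / fact (Suc n)"
    by (rule exp_integral_contraction[OF u(1) _ cont_time_picard _ r L0 L])
       (use u(2) norm_picard_le[of z] z r Suc in \<open>auto intro: order_trans simp del: fact_Suc power_Suc\<close>)
  then show ?case using fix_eq Suc.prems by (simp add: step_def del: fact_Suc power_Suc)
qed

lemma picard_succ_diff_le:
  assumes z: "norm z \<le> r" and r: "r < 1" and L0: "0 \<le> L"
    and L: "\<And>x y. norm x \<le> r \<Longrightarrow> norm y \<le> r \<Longrightarrow> norm (B x - B y) \<le> L * norm (x - y)"
    and t: "0 \<le> t"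
  shows "norm (picard (Suc n) t z - picard n t z) \<le> 2 * (L * t) ^ n / fact n"
  using t
proof (induction n arbitrary: t)
  case 0
  have "norm (picard 1 t z - picard 0 t z) \<le> norm (picard 1 t z) + norm (picard 0 t z)"
    by (rule norm_triangle_ineq4)
  then show ?case using norm_picard_le[of z t 1] 0 z r by simp
next
  case (Suc n)
  have "norm (step (picard (Suc n)) t z - step (picard n) t z) \<le> 2 * (L * t) ^ Suc n / fact (Suc n)"
    unfolding step_def
    by (rule exp_integral_contraction[OF cont_time_picard _ cont_time_picard _ r L0 L])
       (use norm_picard_le[of z] z r Suc in \<open>auto intro: order_trans simp del: fact_Suc power_Suc picard.simps\<close>)
  then show ?case by (simp only: picard.simps(2))
qed

definition flow :: "real \<Rightarrow> complex \<Rightarrow> complex" where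
  "flow t z = lim (\<lambda>n. picard n t z)"

text \<open>The increments telescope, and on this set they are dominated by the terms of a
  convergent exponential series.\<close>

lemma picard_uniform_limit:
  assumes r: "r < 1"
  shows "uniform_limit ({0..T} \<times> cball 0 r) (\<lambda>n (t, z). picard n t z) (\<lambda>(t, z). flow t z) sequentially"
proof -
  obtain L where L: "0 \<le> L" "\<And>x y. norm x \<le> r \<Longrightarrow> norm y \<le> r \<Longrightarrow> norm (B x - B y) \<le> L * norm (x - y)"
    using holomorphic_lipschitz_on_cball[OF holoB r] by blast
  define d where "d n x = picard (Suc n) (fst x) (snd x) - picard n (fst x) (snd x)" for n and x :: "real \<times> complex"
  have u: "uniform_limit ({0..T} \<times> cball 0 r) (\<lambda>n x. \<Sum>i<n. d i x) (\<lambda>x. suminf (\<lambda>i. d i x)) sequentially"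
  proof (rule Weierstrass_m_test)
    fix n and x :: "real \<times> complex" assume x: "x \<in> {0..T} \<times> cball 0 r"
    have "norm (d n x) \<le> 2 * (L * fst x) ^ n / fact n"
      unfolding d_def using x by (intro picard_succ_diff_le[OF _ r L]) auto
    also have "\<dots> \<le> 2 * (L * T) ^ n / fact n"
      using x L by (intro divide_right_mono mult_left_mono power_mono) auto
    finally show "norm (d n x) \<le> 2 * (L * T) ^ n / fact n" .
  next
    have "summable (\<lambda>n. 2 * (inverse (fact n) * (L * T) ^ n))"
      by (intro summable_mult summable_exp)
    then show "summable (\<lambda>n. 2 * (L * T) ^ n / fact n)" by (simp add: field_simps)
  qed
  have tel: "(\<Sum>i<n. d i x) = picard n (fst x) (snd x) - snd x" for n x
    unfolding d_def sum_lessThan_telescope[of "\<lambda>i. picard i (fst x) (snd x)"] by simp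
  have u2: "uniform_limit ({0..T} \<times> cball 0 r) (\<lambda>n x. (\<Sum>i<n. d i x) + snd x) (\<lambda>x. suminf (\<lambda>i. d i x) + snd x) sequentially"
    by (intro uniform_limit_intros u)
  then have u3: "uniform_limit ({0..T} \<times> cball 0 r) (\<lambda>n (t, z). picard n t z) (\<lambda>x. suminf (\<lambda>i. d i x) + snd x) sequentially"
    by (simp add: tel case_prod_beta')
  have "suminf (\<lambda>i. d i x) + snd x = (case x of (t, z) \<Rightarrow> flow t z)" if "x \<in> {0..T} \<times> cball 0 r" for x
    using tendsto_uniform_limitI[OF u3 that] by (auto simp: flow_def case_prod_beta limI)
  then show ?thesis using u3 by (simp cong: uniform_limit_cong')
qed

lemma picard_tendsto_flow:
  assumes "0 \<le> t" "norm z < 1"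
  shows "(\<lambda>n. picard n t z) \<longlonglongrightarrow> flow t z"
  using tendsto_uniform_limitI[OF picard_uniform_limit[OF assms(2), of t], of "(t, z)"] assms by simp

lemma schwarz_family_flow: "schwarz_family flow"
  unfolding schwarz_family_def
proof (intro conjI allI impI ballI)
  show "continuous_on ({0..} \<times> ball 0 1) (\<lambda>(t, z). flow t z)"
    unfolding continuous_on_eq_continuous_within
  proof
    fix x :: "real \<times> complex" assume x: "x \<in> {0..} \<times> ball 0 1"
    \<comment> \<open>A compact box that is a relative neighbourhood of \<open>x\<close> and on
      which the iterates converge uniformly.\<close>
    obtain r where r: "norm (snd x) < r" "r < 1" using x dense[of "norm (snd x)" 1] by (auto simp: mem_Times_iff)
    define T where "T = fst x + 1"
    have "continuous_on ({0..T} \<times> cball 0 r) (\<lambda>(t, z). flow t z)"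
    proof (rule uniform_limit_theorem[OF _ picard_uniform_limit[OF r(2)]])
      have "{0..T} \<times> cball 0 r \<subseteq> {0..} \<times> ball 0 1" using r by auto
      then show "\<forall>\<^sub>F n in sequentially. continuous_on ({0..T} \<times> cball 0 r) (\<lambda>(t, z). picard n t z)"
        using schwarz_family_picard
        by (intro always_eventually allI) (rule continuous_on_subset, auto simp: schwarz_family_def)
    qed auto
    then have "continuous (at x within {0..T} \<times> cball 0 r) (\<lambda>(t, z). flow t z)"
      unfolding continuous_on_eq_continuous_within
      by (rule bspec) (use x r in \<open>auto simp: T_def mem_Times_iff\<close>)
    moreover have "at x within {0..T} \<times> cball 0 r = at x within {0..} \<times> ball 0 1"
      by (rule at_within_nhd[of _ "{..<T} \<times> ball 0 r"])
         (use r x in \<open>auto simp: T_def mem_Times_iff intro!: open_Times\<close>)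
    ultimately show "continuous (at x within {0..} \<times> ball 0 1) (\<lambda>(t, z). flow t z)" by simp
  qed
  fix t :: real assume t: "0 \<le> t"
  show "flow t holomorphic_on ball 0 1"
  proof (rule holomorphic_uniform_sequence[of _ "\<lambda>n. picard n t"])
    show "picard n t holomorphic_on ball 0 1" for n
      using schwarz_family_picard[of n] t by (simp add: schwarz_family_def)
    fix z :: complex assume z: "z \<in> ball 0 1"
    define d where "d = (1 - norm z) / 2"
    define r where "r = (1 + norm z) / 2"
    have dr: "d > 0" "r < 1" using z by (auto simp: d_def r_def)
    have sub: "cball z d \<subseteq> cball 0 r"
    proof
      fix x assume "x \<in> cball z d"
      then show "x \<in> cball 0 r"
        using norm_triangle_sub[of x z] by (simp add: dist_norm norm_minus_commute d_def r_def field_simps)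
    qed
    have "uniform_limit (cball 0 r) (\<lambda>n z. picard n t z) (\<lambda>z. flow t z) sequentially"
    proof (rule uniform_limitI)
      fix e :: real assume "e > 0"
      from uniform_limitD[OF picard_uniform_limit[OF dr(2), of t] this]
      show "\<forall>\<^sub>F n in sequentially. \<forall>x\<in>cball 0 r. dist (picard n t x) (flow t x) < e"
        by eventually_elim (use t in auto)
    qed
    then have "uniform_limit (cball z d) (\<lambda>n. picard n t) (flow t) sequentially"
      using uniform_limit_on_subset sub by blast
    moreover have "cball z d \<subseteq> ball 0 1" using sub dr by (auto simp: subset_iff)
    ultimately show "\<exists>d>0. cball z d \<subseteq> ball 0 1 \<and> uniform_limit (cball z d) (\<lambda>n. picard n t) (flow t) sequentially"
      using dr by blast
  qed auto
  fix z :: complex assume z: "z \<in> ball 0 1"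
  show "norm (flow t z) \<le> norm z"
    by (rule Lim_bounded[OF tendsto_norm[OF picard_tendsto_flow[OF t]], of z 0]) (use z t norm_picard_le in auto)
qed

lemma cont_time_flow: "norm z < 1 \<Longrightarrow> continuous_on {0..} (\<lambda>t. flow t z)"
  using cont_time_family[OF holomorphic_on_ident schwarz_family_flow] .

lemma norm_flow_le: "norm z < 1 \<Longrightarrow> 0 \<le> t \<Longrightarrow> norm (flow t z) \<le> norm z"
  using schwarz_family_flow by (simp add: schwarz_family_def)

text \<open>The limit is taken in \<open>picard (Suc n) = step (picard n)\<close>; the contraction
  estimate with \<open>n = 0\<close> shows that \<open>step\<close> respects uniform
  convergence.\<close>

lemma flow_fixed_point:
  assumes t: "0 \<le> t" and z: "norm z < 1"
  shows "flow t z = z * exp (integral {0..t} (\<lambda>s. B (flow s z)))"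
proof -
  obtain L where L: "0 \<le> L" "\<And>x y. norm x \<le> norm z \<Longrightarrow> norm y \<le> norm z \<Longrightarrow> norm (B x - B y) \<le> L * norm (x - y)"
    using holomorphic_lipschitz_on_cball[OF holoB z] by blast
  have "(\<lambda>n. picard (Suc n) t z) \<longlonglongrightarrow> step flow t z"
  proof (rule tendstoI)
    fix e :: real assume e: "e > 0"
    \<comment> \<open>Chosen so that \<open>K * (L * t) < e\<close>; the summand 1 avoids a zero
      denominator when \<open>L * t = 0\<close>.\<close>
    define K where "K = e / (2 * (L * t + 1))"
    have Lt: "0 \<le> L * t" using L t by simp
    have K: "K > 0" using e Lt unfolding K_def by (intro divide_pos_pos) auto
    have "K * (L * t) \<le> e / 2"
      using e Lt by (simp add: K_def field_simps)
    then have Ke: "K * (L * t) < e" using e by linarith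
    from uniform_limitD[OF picard_uniform_limit[OF z, of t] K]
    show "\<forall>\<^sub>F n in sequentially. dist (picard (Suc n) t z) (step flow t z) < e"
    proof eventually_elim
      case (elim n)
      have "norm (z * exp (integral {0..t} (\<lambda>s. B (picard n s z))) - z * exp (integral {0..t} (\<lambda>s. B (flow s z))))
          \<le> K * (L * t) ^ Suc 0 / fact (Suc 0)"
        by (rule exp_integral_contraction[OF cont_time_picard[OF z] _ cont_time_flow[OF z] _ z L])
           (use norm_picard_le[OF z] norm_flow_le[OF z] t z elim in \<open>auto simp: dist_norm less_imp_le\<close>)
      then show ?case using Ke by (simp add: step_def dist_norm)
    qed
  qed
  moreover have "(\<lambda>n. picard (Suc n) t z) \<longlonglongrightarrow> flow t z"
    using picard_tendsto_flow[OF t z] by (rule LIMSEQ_Suc)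
  ultimately show ?thesis unfolding step_def using LIMSEQ_unique by blast
qed

text \<open>Any such solution is the limit of the same iterates: its distance from
  \<open>picard n\<close> is at most a multiple of an exponential series term, which tends to
  0.\<close>

lemma flow_unique:
  assumes u: "continuous_on {0..} u" "\<And>s. 0 \<le> s \<Longrightarrow> norm (u s) \<le> norm z"
    and eq: "\<And>t. 0 \<le> t \<Longrightarrow> u t = z * exp (integral {0..t} (\<lambda>s. B (u s)))"
    and z: "norm z < 1" and t: "0 \<le> t"
  shows "u t = flow t z"
proof -
  obtain L where L: "0 \<le> L" "\<And>x y. norm x \<le> norm z \<Longrightarrow> norm y \<le> norm z \<Longrightarrow> norm (B x - B y) \<le> L * norm (x - y)"
    using holomorphic_lipschitz_on_cball[OF holoB z] by blast
  have le: "norm (picard n t z - u t) \<le> 2 * (inverse (fact n) * (L * t) ^ n)" for n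
    using picard_diff_le[OF u _ order_refl z L t, of n] eq by (simp add: norm_minus_commute field_simps)
  have "(\<lambda>n. 2 * (inverse (fact n) * (L * t) ^ n)) \<longlonglongrightarrow> 2 * 0"
    by (intro tendsto_intros summable_LIMSEQ_zero summable_exp)
  then have "(\<lambda>n. picard n t z - u t) \<longlonglongrightarrow> 0"
    by (intro Lim_null_comparison[OF always_eventually[OF allI[OF le]]]) simp
  then have "(\<lambda>n. picard n t z) \<longlonglongrightarrow> u t" by (simp add: LIM_zero_iff)
  then show ?thesis using picard_tendsto_flow[OF t z] LIMSEQ_unique by blast
qed

lemma exp_integral_flow_split:
  assumes A: "A holomorphic_on ball 0 1" and s: "0 \<le> s" and t: "0 \<le> t" and z: "norm z < 1"
  shows "exp (integral {0..s + t} (\<lambda>\<sigma>. A (flow \<sigma> z))) =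
     exp (integral {0..t} (\<lambda>\<sigma>. A (flow \<sigma> z))) * exp (integral {0..s} (\<lambda>\<sigma>. A (flow (\<sigma> + t) z)))"
proof -
  have c: "continuous_on {0..} (\<lambda>\<sigma>. A (flow \<sigma> z))"
    by (rule cont_time_family[OF A schwarz_family_flow z])
  have "(\<lambda>\<sigma>. A (flow \<sigma> z)) integrable_on {0..t + s}"
    by (rule integrable_continuous_real) (rule continuous_on_subset[OF c], auto)
  then have "integral {0..t} (\<lambda>\<sigma>. A (flow \<sigma> z)) + integral {t..t + s} (\<lambda>\<sigma>. A (flow \<sigma> z))
      = integral {0..t + s} (\<lambda>\<sigma>. A (flow \<sigma> z))"
    using s t by (intro Henstock_Kurzweil_Integration.integral_combine) auto
  then show ?thesis
    using integral_shift_interval[OF c t, of s] by (simp add: exp_add[symmetric] add.commute)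
qed

text \<open>The curve shifted by \<open>t\<close> solves the integral equation with initial value
  \<open>flow t z\<close>, so uniqueness applies.\<close>

lemma flow_add:
  assumes s: "0 \<le> s" and t: "0 \<le> t" and z: "norm z < 1"
  shows "flow (s + t) z = flow s (flow t z)"
proof -
  define w where "w = flow t z"
  have w: "norm w < 1" using norm_flow_le[OF z t] z by (simp add: w_def)
  have eq: "flow (\<sigma> + t) z = w * exp (integral {0..\<sigma>} (\<lambda>\<sigma>. B (flow (\<sigma> + t) z)))" if "0 \<le> \<sigma>" for \<sigma>
    using flow_fixed_point[of "\<sigma> + t" z] flow_fixed_point[OF t z] exp_integral_flow_split[OF holoB that t z] that t z
    by (simp add: w_def)
  have c: "continuous_on {0..} (\<lambda>\<sigma>. A (flow (\<sigma> + t) z))" if "A holomorphic_on ball 0 1" for A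
    by (rule continuous_on_compose2[OF cont_time_family[OF that schwarz_family_flow z]])
       (use t in \<open>auto intro!: continuous_intros\<close>)
  have "norm (flow (\<sigma> + t) z) \<le> norm w" if "0 \<le> \<sigma>" for \<sigma>
    unfolding eq[OF that]
  proof (rule norm_mult_exp_integral_le)
    show "continuous_on {0..\<sigma>} (\<lambda>\<sigma>. B (flow (\<sigma> + t) z))"
      by (rule continuous_on_subset[OF c[OF holoB]]) auto
    show "Re (B (flow (\<sigma>' + t) z)) \<le> 0" if "\<sigma>' \<in> {0..\<sigma>}" for \<sigma>'
      using norm_flow_le[OF z, of "\<sigma>' + t"] that t z by (intro ReB) auto
  qed
  from flow_unique[OF c[OF holomorphic_on_ident] this eq w s] show ?thesis by (simp add: w_def)
qed

end

section \<open>From differential equations to convolution semigroups\<close>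

lemma ode_imp_cmc_semigroup:
  assumes B1: "admissible_B B1" and B2: "admissible_B B2"
  shows "\<exists>\<mu> \<nu>. cmc_semigroup \<mu> \<nu> \<and> \<mu> 0 = delta1 \<and> \<nu> 0 = delta1 \<and> cmc_ode \<mu> \<nu> B1 B2"
proof -
  interpret disc_field B2
    by standard (use B2 in \<open>auto simp: admissible_B_def unit_disc_def\<close>)
  \<comment> \<open>The transforms to be realised: \<open>A = B1\<close> for \<open>\<mu>\<close>
    and \<open>A = B2\<close> for \<open>\<nu>\<close>, the latter being the flow itself by its
    fixed-point equation.\<close>
  define E where "E A t z = z * exp (integral {0..t} (\<lambda>s. A (flow s z)))" for A :: "complex \<Rightarrow> complex" and t z
  have E: "E A t holomorphic_on ball 0 1" "norm z < 1 \<Longrightarrow> 0 \<le> t \<Longrightarrow> norm (E A t z) \<le> norm z"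
      "norm z < 1 \<Longrightarrow> 0 \<le> t \<Longrightarrow>
         ((\<lambda>t. E A t z) has_vector_derivative E A t z * A (flow t z)) (at t within {0..})"
    if A: "admissible_B A" for A t z
  proof -
    have hA: "A holomorphic_on ball 0 1" and RA: "\<And>z. norm z < 1 \<Longrightarrow> Re (A z) \<le> 0"
      using A by (auto simp: admissible_B_def unit_disc_def)
    show "E A t holomorphic_on ball 0 1"
      unfolding E_def by (rule holomorphic_exp_integral_family[OF hA schwarz_family_flow])
    assume z: "norm z < 1" and t: "0 \<le> t"
    have c: "continuous_on {0..} (\<lambda>s. A (flow s z))" by (rule cont_time_family[OF hA schwarz_family_flow z])
    show "norm (E A t z) \<le> norm z"
      unfolding E_def
    proof (rule norm_mult_exp_integral_le)
      show "continuous_on {0..t} (\<lambda>s. A (flow s z))" by (rule continuous_on_subset[OF c]) auto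
      show "Re (A (flow s z)) \<le> 0" if "s \<in> {0..t}" for s
        using that by (intro RA schwarz_family_maps[OF schwarz_family_flow _ z]) auto
    qed
    show "((\<lambda>t. E A t z) has_vector_derivative E A t z * A (flow t z)) (at t within {0..})"
      unfolding E_def by (rule has_vector_derivative_exp_integral[OF c t])
  qed
  \<comment> \<open>At \<open>t = 0\<close> the measure is chosen to be \<open>delta1\<close>
    itself, so that the initial condition is an equality of measures and not only of
    transforms.\<close>
  have ex: "\<exists>\<mu>. prob_T \<mu> \<and> (\<forall>z\<in>ball 0 1. eta_tr \<mu> z = E A t z) \<and> (t = 0 \<longrightarrow> \<mu> = delta1)"
    if A: "admissible_B A" and t: "0 \<le> t" for A t
  proof (cases "t = 0")
    case True
    then show ?thesis by (intro exI[of _ delta1]) (auto simp: prob_T_delta1 eta_tr_delta1 E_def)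
  next
    case False
    then show ?thesis using exists_prob_T_eta_tr[OF E(1)[OF A] E(2)[OF A _ t]] by simp
  qed
  obtain \<mu> where \<mu>: "\<And>t. 0 \<le> t \<Longrightarrow> prob_T (\<mu> t)" "\<mu> 0 = delta1"
      "\<And>t z. 0 \<le> t \<Longrightarrow> z \<in> ball 0 1 \<Longrightarrow> eta_tr (\<mu> t) z = E B1 t z"
    using ex[OF B1] by (metis order_refl)
  obtain \<nu> where \<nu>: "\<And>t. 0 \<le> t \<Longrightarrow> prob_T (\<nu> t)" "\<nu> 0 = delta1"
      "\<And>t z. 0 \<le> t \<Longrightarrow> z \<in> ball 0 1 \<Longrightarrow> eta_tr (\<nu> t) z = E B2 t z"
    using ex[OF B2] by (metis order_refl)
  have \<nu>f: "eta_tr (\<nu> t) z = flow t z" if "0 \<le> t" "z \<in> ball 0 1" for t z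
    using \<nu>(3)[OF that] flow_fixed_point[OF that(1), of z] that by (simp add: E_def)
  have ode: "((\<lambda>s. eta_tr (\<rho> s) z) has_vector_derivative eta_tr (\<rho> t) z * A (eta_tr (\<nu> t) z)) (at t within {0..})"
    if A: "admissible_B A" and t: "0 \<le> t" and z: "z \<in> ball 0 1"
      and \<rho>: "\<And>t z. 0 \<le> t \<Longrightarrow> z \<in> ball 0 1 \<Longrightarrow> eta_tr (\<rho> t) z = E A t z" for A \<rho> t z
    unfolding \<rho>[OF t z] \<nu>f[OF t z]
    by (rule has_vector_derivative_transform[OF _ _ E(3)[OF A]]) (use t z \<rho> in auto)
  have weak: "weakly_continuous \<rho>"
    if A: "admissible_B A" and p: "\<And>t. 0 \<le> t \<Longrightarrow> prob_T (\<rho> t)"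
      and \<rho>: "\<And>t z. 0 \<le> t \<Longrightarrow> z \<in> ball 0 1 \<Longrightarrow> eta_tr (\<rho> t) z = E A t z" for A \<rho>
  proof (rule weakly_continuous_if_eta_tr[OF p])
    fix z :: complex assume z: "norm z < 1"
    show "continuous_on {0..} (\<lambda>t. eta_tr (\<rho> t) z)"
      unfolding continuous_on_eq_continuous_within
      using ode[OF A _ _ \<rho>, of _ z] z has_vector_derivative_continuous by fastforce
  qed
  have conv: "cmc_conv (\<mu> s) (\<nu> s) (\<mu> t) (\<nu> t) (\<mu> (s + t)) (\<nu> (s + t))" if s: "0 \<le> s" and t: "0 \<le> t" for s t
    unfolding cmc_conv_def unit_disc_def
  proof (intro ballI conjI)
    fix z :: complex assume z: "z \<in> ball 0 1"
    have w: "flow t z \<in> ball 0 1" using z schwarz_family_maps[OF schwarz_family_flow t, of z] by simp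
    show "eta_tr (\<nu> (s + t)) z = eta_tr (\<nu> s) (eta_tr (\<nu> t) z)"
      using s t z w by (simp add: \<nu>f flow_add)
    show "eta_tr (\<mu> (s + t)) z = eta_tr (\<mu> t) z * h_tr (\<mu> s) (eta_tr (\<nu> t) z)"
    \<comment> \<open>At 0 both sides vanish. Elsewhere \<open>flow t z\<close> is nonzero, so
      \<open>h_tr\<close> takes its quotient branch and equals the exponential factor.\<close>
    proof (cases "z = 0")
      case True
      then show ?thesis using s t by (simp add: \<mu>(3) E_def)
    next
      case False
      then have "flow t z \<noteq> 0" using flow_fixed_point[OF t, of z] z by simp
      then have "h_tr (\<mu> s) (flow t z) = exp (integral {0..s} (\<lambda>\<sigma>. B1 (flow \<sigma> (flow t z))))"
        using \<mu>(3)[OF s w] by (simp add: h_tr_def E_def)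
      also have "integral {0..s} (\<lambda>\<sigma>. B1 (flow \<sigma> (flow t z))) = integral {0..s} (\<lambda>\<sigma>. B1 (flow (\<sigma> + t) z))"
        by (rule integral_cong) (use t z in \<open>simp add: flow_add\<close>)
      finally show ?thesis
        using exp_integral_flow_split[of B1 s t z] B1 s t z
        by (simp add: \<mu>(3) \<nu>f E_def admissible_B_def unit_disc_def)
    qed
  qed
  have "cmc_semigroup \<mu> \<nu>"
    unfolding cmc_semigroup_def
    using \<mu>(1) \<nu>(1) conv weak[OF B1 \<mu>(1,3)] weak[OF B2 \<nu>(1,3)] by blast
  moreover have "cmc_ode \<mu> \<nu> B1 B2"
    unfolding cmc_ode_def unit_disc_def
    using ode[OF B1 _ _ \<mu>(3)] ode[OF B2 _ _ \<nu>(3)] by blast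
  ultimately show ?thesis using \<mu>(2) \<nu>(2) by blast
qed

theorem theorem4p5:
  shows
   "(\<forall>\<mu> \<nu>. cmc_semigroup \<mu> \<nu> \<and> \<mu> 0 = delta1 \<and> \<nu> 0 = delta1 \<longrightarrow>
       (\<exists>B1 B2. admissible_B B1 \<and> admissible_B B2 \<and> cmc_ode \<mu> \<nu> B1 B2))
    \<and> (\<forall>B1 B2. admissible_B B1 \<and> admissible_B B2 \<longrightarrow>
       (\<exists>\<mu> \<nu>. cmc_semigroup \<mu> \<nu> \<and> \<mu> 0 = delta1 \<and> \<nu> 0 = delta1 \<and> cmc_ode \<mu> \<nu> B1 B2))
    \<and> (\<forall>B. admissible_B B \<longrightarrow>
       (\<exists>(\<gamma>::real) \<tau>. finite_meas_T \<tau> \<and>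
          (\<forall>z\<in>unit_disc. B z = \<i> * complex_of_real \<gamma> + (\<integral>\<zeta>. (z + \<zeta>) / (z - \<zeta>) \<partial>\<tau>))))"
  using cmc_semigroup_imp_ode ode_imp_cmc_semigroup herglotz_representation by blast

end
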